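(* Let $\Phi$ be an irreducible (crystallographic) root system of rank $n$, and let $c_1,\ldots,c_n$ be non-negative integers with $c_1+\cdots+c_n=n$. Then the mixed $\Phi$-Eulerian number $A^{\Phi}_{c_1,\ldots,c_n}$ is given by $$A^{\Phi}_{c_1,\ldots,c_n}=\frac{|W_\Phi|}{\det(C_\Phi)}\left[M_1^{c_1}\cdots M_n^{c_n}\right]_{\emptyset,\Delta},$$ where, for $i\in\Delta$, $M_i=(m_{i,J}^K)_{J,K\subset\Delta}$ is the $2^n\times 2^n$ matrix with rows indexed by $J\subset\Delta$ and columns indexed by $K\subset\Delta$ with entries $$m^{K}_{i,J}=\begin{cases}\dfrac{[C_K^{-1}]_{i,s}}{[C_K^{-1}]_{s,s}}, & \text{if } i\in K,\ |K|=|J|+1,\ \text{and } K\setminus J=\{s\},\\ 0, & \text{otherwise,}\end{cases}$$ and $[\ \cdot\ ]_{\emptyset,\Delta}$ denotes the entry in the row indexed by $\emptyset$ and the column indexed by $\Delta$.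
   Context: $\Delta=\{\alpha_1,\ldots,\alpha_n\}$ is a set of simple roots of $\Phi$ (also identified with the index set $\{1,\ldots,n\}$), $W=W_\Phi$ is the Weyl group, and $\varpi_1,\ldots,\varpi_n$ are the fundamental weights. The Cartan matrix is $C_\Phi=C_\Delta=(c_{ij})_{i,j\in\Delta}$ with $c_{ij}=\langle\alpha_i,\alpha_j\rangle=2(\alpha_i,\alpha_j)/(\alpha_j,\alpha_j)$; for $K\subset\Delta$, $C_K=(c_{ij})_{i,j\in K}$, and $[C_K^{-1}]_{j,k}$ is the $(j,k)$-entry of its inverse. Subsets of $\Delta$ are ordered lexicographically as row/column indices. For $\chi$ in the real weight space $\Lambda_{\mathbb R}$, the weight polytope $P_\Phi(\chi)$ is the convex hull of the orbit $\{w(\chi)\mid w\in W\}$. Volume is normalised so that the parallelepiped generated by $\alpha_1,\ldots,\alpha_n$ has volume $1$. The function $V_\Phi(u_1,\ldots,u_n)=\text{volume of }P_\Phi(u_1\varpi_1+\cdots+u_n\varpi_n)$ (for $u_1,\dots,u_n\ge 0$) is a homogeneous polynomial of degree $n$, and the mixed $\Phi$-Eulerian numbers $A^\Phi_{c_1,\ldots,c_n}$ are defined by $$V_\Phi(u_1,\ldots,u_n)=\sum_{c_1+\cdots+c_n=n}A^\Phi_{c_1,\ldots,c_n}\frac{u_1^{c_1}}{c_1!}\cdots\frac{u_n^{c_n}}{c_n!}.$$ *)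

theory Defs
  imports "HOL-Analysis.Analysis"
begin

text \<open>
  The ambient Euclidean space \<open>'a\<close> is the real span of the root system, so that it is also the
  real weight space and the rank is the dimension of \<open>'a\<close>.  Simple roots are indexed by a finite
  linearly ordered type \<open>'n\<close>, which plays the role of \<open>{1, \<dots>, n}\<close> with \<open>n = CARD('n)\<close>; the order
  is only used to write ordered products.
\<close>

definition reflection :: "'a::euclidean_space \<Rightarrow> 'a \<Rightarrow> 'a" where
  "reflection \<beta> v = v - (2 * (v \<bullet> \<beta>) / (\<beta> \<bullet> \<beta>)) *\<^sub>R \<beta>"

definition root_system :: "'a::euclidean_space set \<Rightarrow> bool" where
  "root_system \<Phi> \<longleftrightarrow>
     finite \<Phi> \<and> span \<Phi> = UNIV \<and> 0 \<notin> \<Phi> \<and>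
     (\<forall>\<beta>\<in>\<Phi>. \<forall>t. t *\<^sub>R \<beta> \<in> \<Phi> \<longleftrightarrow> t = 1 \<or> t = -1) \<and>
     (\<forall>\<beta>\<in>\<Phi>. \<forall>\<gamma>\<in>\<Phi>. reflection \<beta> \<gamma> \<in> \<Phi>) \<and>
     (\<forall>\<beta>\<in>\<Phi>. \<forall>\<gamma>\<in>\<Phi>. 2 * (\<gamma> \<bullet> \<beta>) / (\<beta> \<bullet> \<beta>) \<in> \<int>)"

definition irreducible_root_system :: "'a::euclidean_space set \<Rightarrow> bool" where
  "irreducible_root_system \<Phi> \<longleftrightarrow>
     root_system \<Phi> \<and> \<Phi> \<noteq> {} \<and>
     \<not> (\<exists>A B. A \<noteq> {} \<and> B \<noteq> {} \<and> A \<union> B = \<Phi> \<and> A \<inter> B = {} \<and>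
          (\<forall>a\<in>A. \<forall>b\<in>B. a \<bullet> b = 0))"

definition simple_roots :: "'a::euclidean_space set \<Rightarrow> ('n::finite \<Rightarrow> 'a) \<Rightarrow> bool" where
  "simple_roots \<Phi> \<alpha> \<longleftrightarrow>
     inj \<alpha> \<and> range \<alpha> \<subseteq> \<Phi> \<and> independent (range \<alpha>) \<and> span (range \<alpha>) = UNIV \<and>
     (\<forall>\<beta>\<in>\<Phi>. \<exists>m :: 'n \<Rightarrow> int. \<beta> = (\<Sum>i\<in>UNIV. of_int (m i) *\<^sub>R \<alpha> i) \<and>
        ((\<forall>i. m i \<ge> 0) \<or> (\<forall>i. m i \<le> 0)))"

text \<open>Reflections are involutions, so their closure under composition is the group they generate.\<close>

inductive_set weyl_group :: "('a::euclidean_space) set \<Rightarrow> ('a \<Rightarrow> 'a) set" for \<Phi> where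
  id: "id \<in> weyl_group \<Phi>"
| reflection: "\<lbrakk>\<beta> \<in> \<Phi>; w \<in> weyl_group \<Phi>\<rbrakk> \<Longrightarrow> reflection \<beta> \<circ> w \<in> weyl_group \<Phi>"

definition fundamental_weight :: "('n::finite \<Rightarrow> 'a::euclidean_space) \<Rightarrow> 'n \<Rightarrow> 'a" where
  "fundamental_weight \<alpha> i =
     (THE v. \<forall>j. 2 * (v \<bullet> \<alpha> j) / (\<alpha> j \<bullet> \<alpha> j) = (if i = j then 1 else 0))"

definition cartan_matrix :: "('n::finite \<Rightarrow> 'a::euclidean_space) \<Rightarrow> real ^ 'n ^ 'n" where
  "cartan_matrix \<alpha> = (\<chi> i j. 2 * (\<alpha> i \<bullet> \<alpha> j) / (\<alpha> j \<bullet> \<alpha> j))"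

definition weight_polytope :: "'a::euclidean_space set \<Rightarrow> 'a \<Rightarrow> 'a set" where
  "weight_polytope \<Phi> x = convex hull ((\<lambda>w. w x) ` weyl_group \<Phi>)"

definition parallelepiped :: "('n::finite \<Rightarrow> 'a::euclidean_space) \<Rightarrow> 'a set" where
  "parallelepiped \<alpha> = {\<Sum>i\<in>UNIV. t i *\<^sub>R \<alpha> i | t. \<forall>i. 0 \<le> t i \<and> t i \<le> 1}"

definition normalized_volume :: "('n::finite \<Rightarrow> 'a::euclidean_space) \<Rightarrow> 'a set \<Rightarrow> real" where
  "normalized_volume \<alpha> S = measure lebesgue S / measure lebesgue (parallelepiped \<alpha>)"

definition volume_function ::
    "'a::euclidean_space set \<Rightarrow> ('n::finite \<Rightarrow> 'a) \<Rightarrow> ('n \<Rightarrow> real) \<Rightarrow> real" where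
  "volume_function \<Phi> \<alpha> u =
     normalized_volume \<alpha> (weight_polytope \<Phi> (\<Sum>i\<in>UNIV. u i *\<^sub>R fundamental_weight \<alpha> i))"

text \<open>
  The family of coefficients of the volume polynomial; it is set to 0 outside the exponent
  vectors of total degree \<open>n\<close> so that it is unique as a function.
\<close>

definition mixed_eulerian ::
    "'a::euclidean_space set \<Rightarrow> ('n::finite \<Rightarrow> 'a) \<Rightarrow> ('n \<Rightarrow> nat) \<Rightarrow> real" where
  "mixed_eulerian \<Phi> \<alpha> =
     (THE A. (\<forall>c. (\<Sum>i\<in>UNIV. c i) \<noteq> CARD('n) \<longrightarrow> A c = 0) \<and>
        (\<forall>u. (\<forall>i. u i \<ge> 0) \<longrightarrow>
           volume_function \<Phi> \<alpha> u =
             (\<Sum>c | (\<Sum>i\<in>UNIV. c i) = CARD('n). A c * (\<Prod>i\<in>UNIV. u i ^ c i / fact (c i)))))"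

text \<open>
  The inverse of the principal submatrix \<open>(C $ i $ j)\<close> with \<open>i, j \<in> K\<close>, where the entries outside
  \<open>K \<times> K\<close> are set to 0.
\<close>

definition principal_inverse :: "real ^ 'n ^ 'n \<Rightarrow> 'n::finite set \<Rightarrow> real ^ 'n ^ 'n" where
  "principal_inverse C K =
     (THE D. (\<forall>i j. i \<notin> K \<or> j \<notin> K \<longrightarrow> D $ i $ j = 0) \<and>
        (\<forall>i\<in>K. \<forall>j\<in>K.
           (\<Sum>k\<in>K. C $ i $ k * D $ k $ j) = (if i = j then 1 else 0) \<and>
           (\<Sum>k\<in>K. D $ i $ k * C $ k $ j) = (if i = j then 1 else 0)))"

text \<open>Row index \<open>J\<close>, column index \<open>K\<close>.\<close>

definition subset_matrix ::
    "('n::finite \<Rightarrow> 'a::euclidean_space) \<Rightarrow> 'n \<Rightarrow> real ^ ('n set) ^ ('n set)" where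
  "subset_matrix \<alpha> i = (\<chi> J K.
     if i \<in> K \<and> card K = card J + 1 \<and> is_singleton (K - J)
     then (let s = the_elem (K - J); D = principal_inverse (cartan_matrix \<alpha>) K
           in D $ i $ s / D $ s $ s)
     else 0)"

definition matrix_power :: "real ^ 'm ^ 'm \<Rightarrow> nat \<Rightarrow> real ^ 'm ^ ('m::finite)" where
  "matrix_power A k = (((**) A) ^^ k) (mat 1)"

text \<open>
  The product of \<open>M i\<close> to the power \<open>c i\<close>, with the factors in increasing order of \<open>i\<close> from left to right.
\<close>

definition ordered_product ::
    "('n::{finite,linorder} \<Rightarrow> real ^ 'm ^ 'm) \<Rightarrow> ('n \<Rightarrow> nat) \<Rightarrow> real ^ 'm ^ ('m::finite)" where
  "ordered_product M c =
     foldr (\<lambda>i X. matrix_power (M i) (c i) ** X) (sorted_list_of_set UNIV) (mat 1)"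

end

theory Submission
  imports Defs
begin

text \<open>
  Let \<open>\<chi> = u\<^sub>1 \<omega>\<^sub>1 + \<dots> + u\<^sub>n \<omega>\<^sub>n\<close> be dominant.  The Weyl group \<open>W\<close> permutes the closed chambers, two distinct
  chambers meet in a null set, and a dominant point \<open>x\<close> lies in the weight polytope of \<open>\<chi>\<close> exactly if
  \<open>\<chi> - x\<close> is a non-negative combination of simple roots.  So the volume of the polytope is \<open>|W|\<close> times the
  volume of its dominant part.  In the coordinates \<open>y\<close> with respect to the fundamental weights, in which
  the parallelepiped of the simple roots has volume \<open>det C\<close>, the dominant part is the region
  \<open>{y. y \<ge> 0 \<and> (u - y) C\<^sup>-\<^sup>1 \<ge> 0}\<close>.

  Such a region makes sense for every principal submatrix \<open>C\<^sub>K\<close> (\<open>emeasure_region\<close>).  Let \<open>f\<^sub>K(u)\<close> be its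
  volume and \<open>D = C\<^sub>K\<^sup>-\<^sup>1\<close>.  The facets that do not contain the origin are given by \<open>((u - y) D)\<^sub>s = 0\<close> for
  \<open>s \<in> K\<close>; the region is the union of the cones over them, and forgetting the coordinate \<open>s\<close> maps the
  facet onto the region of \<open>K - {s}\<close>.  This needs only that \<open>D\<close> has non-negative entries and that \<open>C\<close> has
  non-positive off-diagonal entries, and it gives
  \<open>|K| f\<^sub>K(u) = \<Sum>s\<in>K. (u D)\<^sub>s / D\<^sub>s\<^sub>s * f\<^bsub>K - {s}\<^esub>(u)\<close>,
  which says that the row vector \<open>f\<close> satisfies \<open>|K| f\<^sub>K = (\<Sum>i. u\<^sub>i f M\<^sub>i)\<^sub>K\<close>.  The matrices \<open>M\<^sub>i\<close> commute
  (\<open>step_matrix_commute\<close>), because a principal inverse changes by a Schur complement when an index is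
  removed.  Hence the polynomial with coefficients \<open>[M\<^sub>1^c\<^sub>1 \<cdots> M\<^sub>n^c\<^sub>n]\<close> in row \<open>\<emptyset>\<close> and column \<open>K\<close> solves the
  same recursion (\<open>volume_poly_rec\<close>) and equals \<open>f\<^sub>K\<close>.  The mixed Eulerian numbers are then read off, as a
  polynomial is determined by its values on the non-negative orthant.
\<close>

section \<open>The Weyl group and its dominant chamber\<close>

lemma inner_reflection: "reflection \<beta> v \<bullet> w = v \<bullet> w - (2 * (v \<bullet> \<beta>) / (\<beta> \<bullet> \<beta>)) * (\<beta> \<bullet> w)"
  by (simp add: reflection_def inner_diff_left)

lemma linear_reflection: "linear (reflection \<beta>)"
  unfolding reflection_def
  by (rule linearI) (auto simp: algebra_simps add_divide_distrib)

lemma reflection_reflection: "reflection \<beta> (reflection \<beta> v) = v"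
proof (cases "\<beta> = 0")
  case False
  then have "reflection \<beta> v \<bullet> \<beta> = - (v \<bullet> \<beta>)"
    by (simp add: inner_reflection)
  then show ?thesis
    by (subst reflection_def) (simp add: reflection_def)
qed (simp add: reflection_def)

lemma reflection_isometry: "reflection \<beta> v \<bullet> reflection \<beta> w = v \<bullet> w"
proof (cases "\<beta> = 0")
  case False
  then show ?thesis
    by (simp add: reflection_def inner_diff_left inner_diff_right inner_commute[of \<beta> w] field_simps)
qed (simp add: reflection_def)

lemma finite_maximiser:
  fixes f :: "'b \<Rightarrow> real"
  assumes "finite X" "X \<noteq> {}"
  obtains x where "x \<in> X" "\<And>y. y \<in> X \<Longrightarrow> f y \<le> f x"
proof -
  have "Max (f ` X) \<in> f ` X" using assms by simp
  moreover have "f y \<le> Max (f ` X)" if "y \<in> X" for y using assms that by simp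
  ultimately show thesis using that by auto
qed

text \<open>
  A root system with a choice of simple roots.  Inside the locale, \<open>\<omega> i\<close> is the fundamental weight and
  \<open>s i\<close> the simple reflection with index \<open>i\<close>.
\<close>

locale root_basis =
  fixes \<Phi> :: "'a::euclidean_space set" and \<alpha> :: "'n::finite \<Rightarrow> 'a"
  assumes root_system: "root_system \<Phi>" and simple_roots: "simple_roots \<Phi> \<alpha>"
begin

abbreviation \<omega> :: "'n \<Rightarrow> 'a" where "\<omega> \<equiv> fundamental_weight \<alpha>"
abbreviation s :: "'n \<Rightarrow> 'a \<Rightarrow> 'a" where "s i \<equiv> reflection (\<alpha> i)"

lemma inj_simple: "inj \<alpha>" and simple_root: "\<alpha> i \<in> \<Phi>"
  and independent_simple: "independent (range \<alpha>)" and span_simple: "span (range \<alpha>) = UNIV"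
  using simple_roots unfolding simple_roots_def by auto

lemma finite_roots: "finite \<Phi>" and span_roots: "span \<Phi> = UNIV" and zero_not_root: "0 \<notin> \<Phi>"
  and reflection_root: "\<beta> \<in> \<Phi> \<Longrightarrow> \<gamma> \<in> \<Phi> \<Longrightarrow> reflection \<beta> \<gamma> \<in> \<Phi>"
  and scale_root: "\<beta> \<in> \<Phi> \<Longrightarrow> t *\<^sub>R \<beta> \<in> \<Phi> \<longleftrightarrow> t = 1 \<or> t = -1"
  using root_system unfolding root_system_def by auto

lemma simple_nonzero: "\<alpha> i \<noteq> 0"
  using simple_root[of i] zero_not_root by auto

lemma simple_inner_pos: "\<alpha> i \<bullet> \<alpha> i > 0"
  using simple_nonzero by simp

lemma card_index: "CARD('n) = DIM('a)"
proof -
  have "card (range \<alpha>) = DIM('a)"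
    using independent_simple span_simple
    by (metis dim_UNIV dim_span dim_eq_card_independent)
  then show ?thesis using card_image[OF inj_simple] by simp
qed

lemma eq_if_inner_simple_eq:
  assumes "\<And>i. v \<bullet> \<alpha> i = w \<bullet> \<alpha> i"
  shows "v = w"
proof -
  have "(v - w) \<bullet> x = 0" for x
  proof -
    have "x \<in> span (range \<alpha>)" using span_simple by simp
    then show ?thesis
      by (induction rule: span_induct_alt)
         (use assms in \<open>auto simp: inner_add_right inner_diff_left\<close>)
  qed
  then have "(v - w) \<bullet> (v - w) = 0" by blast
  then show ?thesis by simp
qed

lemma fundamental_weight_inner:
  "\<omega> i \<bullet> \<alpha> j = (if i = j then (\<alpha> i \<bullet> \<alpha> i) / 2 else 0)"
proof -
  obtain g :: "'a \<Rightarrow> real" where g: "linear g" "\<forall>x\<in>range \<alpha>. g x = (if x = \<alpha> i then (\<alpha> i \<bullet> \<alpha> i) / 2 else 0)"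
    using linear_independent_extend[OF independent_simple,
        of "\<lambda>x. if x = \<alpha> i then (\<alpha> i \<bullet> \<alpha> i) / 2 else 0"] by auto
  define v where "v = adjoint g 1"
  have v: "v \<bullet> \<alpha> j = (if i = j then (\<alpha> i \<bullet> \<alpha> i) / 2 else 0)" for j
  proof -
    have "\<alpha> j \<bullet> v = g (\<alpha> j) \<bullet> 1" unfolding v_def by (rule adjoint_works[OF g(1)])
    then show ?thesis using g(2)[rule_format, of "\<alpha> j"]
      by (simp add: inner_commute[of v] inj_eq[OF inj_simple] eq_commute[of j i])
  qed
  have "\<exists>!v. \<forall>j. 2 * (v \<bullet> \<alpha> j) / (\<alpha> j \<bullet> \<alpha> j) = (if i = j then 1 else 0)"
  proof (rule ex1I[of _ v])
    show "\<forall>j. 2 * (v \<bullet> \<alpha> j) / (\<alpha> j \<bullet> \<alpha> j) = (if i = j then 1 else 0)"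
      using v simple_nonzero by auto
  next
    fix w assume w: "\<forall>j. 2 * (w \<bullet> \<alpha> j) / (\<alpha> j \<bullet> \<alpha> j) = (if i = j then 1 else 0)"
    have "w \<bullet> \<alpha> j = v \<bullet> \<alpha> j" for j
      using w[rule_format, of j] v[of j] simple_inner_pos[of j] by (cases "i = j") (auto simp: field_simps)
    then show "w = v" by (rule eq_if_inner_simple_eq)
  qed
  from theI'[OF this] have "2 * (\<omega> i \<bullet> \<alpha> j) / (\<alpha> j \<bullet> \<alpha> j) = (if i = j then 1 else 0)"
    unfolding fundamental_weight_def by blast
  then show ?thesis using simple_inner_pos[of j] by (cases "i = j") (auto simp: field_simps)
qed

lemma weight_expansion: "v = (\<Sum>i\<in>UNIV. (2 * (v \<bullet> \<alpha> i) / (\<alpha> i \<bullet> \<alpha> i)) *\<^sub>R \<omega> i)"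
proof (rule eq_if_inner_simple_eq)
  fix j
  show "v \<bullet> \<alpha> j = (\<Sum>i\<in>UNIV. (2 * (v \<bullet> \<alpha> i) / (\<alpha> i \<bullet> \<alpha> i)) *\<^sub>R \<omega> i) \<bullet> \<alpha> j"
    using simple_nonzero[of j]
    by (simp add: inner_sum_left fundamental_weight_inner if_distrib cong: if_cong)
qed

lemma simple_sum_inner:
  "(\<Sum>i\<in>UNIV. m i *\<^sub>R \<alpha> i) \<bullet> \<omega> j = m j * ((\<alpha> j \<bullet> \<alpha> j) / 2)"
  by (simp add: inner_sum_left inner_commute[of "\<alpha> _" "\<omega> _"] fundamental_weight_inner if_distrib cong: if_cong)

lemma eq_if_inner_weight_eq:
  assumes "\<And>i. v \<bullet> \<omega> i = w \<bullet> \<omega> i"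
  shows "v = w"
proof (rule vector_eq_rdot[THEN iffD1], rule allI)
  fix z
  have "v \<bullet> z = w \<bullet> z" using assms
    by (subst (1 2) weight_expansion[of z]) (simp add: inner_sum_right)
  then show "v \<bullet> z = w \<bullet> z" .
qed

lemma simple_expansion: "v = (\<Sum>i\<in>UNIV. (2 * (v \<bullet> \<omega> i) / (\<alpha> i \<bullet> \<alpha> i)) *\<^sub>R \<alpha> i)"
  by (rule eq_if_inner_weight_eq) (use simple_nonzero in \<open>simp add: simple_sum_inner\<close>)

text \<open>
  Membership in the closed dominant chamber.
\<close>

definition dominant :: "'a \<Rightarrow> bool" where "dominant v \<longleftrightarrow> (\<forall>i. 0 \<le> v \<bullet> \<alpha> i)"

text \<open>
  Membership in the cone spanned by the simple roots.  The coefficient of \<open>\<alpha> i\<close> in \<open>v\<close> is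
  \<open>2 * (v \<bullet> \<omega> i) / (\<alpha> i \<bullet> \<alpha> i)\<close> (\<open>simple_expansion\<close>), so that the cone is dual to the fundamental weights.
\<close>

definition positive :: "'a \<Rightarrow> bool" where "positive v \<longleftrightarrow> (\<forall>i. 0 \<le> v \<bullet> \<omega> i)"

lemma positive_add: "positive v \<Longrightarrow> positive w \<Longrightarrow> positive (v + w)"
  by (simp add: positive_def inner_add_left)

lemma positive_scale: "0 \<le> c \<Longrightarrow> positive v \<Longrightarrow> positive (c *\<^sub>R v)"
  by (simp add: positive_def)

lemma positive_antisym: "positive v \<Longrightarrow> positive (- v) \<Longrightarrow> v = 0"
  by (rule eq_if_inner_weight_eq) (simp add: positive_def order_antisym)

lemma positive_simple: "positive (\<alpha> i)"
  by (simp add: positive_def inner_commute[of "\<alpha> _" "\<omega> _"] fundamental_weight_inner)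

lemma positive_dominant_inner:
  assumes "positive v" "dominant w" shows "0 \<le> v \<bullet> w"
  by (subst simple_expansion[of v])
     (use assms in \<open>auto simp: inner_sum_left positive_def dominant_def inner_commute[of "\<alpha> _" w]
        intro!: sum_nonneg mult_nonneg_nonneg divide_nonneg_nonneg\<close>)

lemma root_sign:
  assumes "\<beta> \<in> \<Phi>" shows "positive \<beta> \<or> positive (- \<beta>)"
proof -
  obtain m :: "'n \<Rightarrow> int" where m: "\<beta> = (\<Sum>i\<in>UNIV. of_int (m i) *\<^sub>R \<alpha> i)"
    "(\<forall>i. m i \<ge> 0) \<or> (\<forall>i. m i \<le> 0)"
    using simple_roots assms unfolding simple_roots_def by blast
  have "\<beta> \<bullet> \<omega> j = of_int (m j) * ((\<alpha> j \<bullet> \<alpha> j) / 2)" for j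
    unfolding m(1) by (rule simple_sum_inner)
  then have coeff: "\<beta> \<bullet> \<omega> j = of_int (m j) * ((\<alpha> j \<bullet> \<alpha> j) / 2)" for j by blast
  show ?thesis
    using m(2) unfolding positive_def inner_minus_left coeff by (auto simp: mult_le_0_iff)
qed

text \<open>
  A simple reflection changes only one simple coefficient of a root, and both signs cannot occur; so
  it permutes the positive roots other than \<open>\<alpha> i\<close>.
\<close>

lemma simple_reflection_positive:
  assumes "\<beta> \<in> \<Phi>" "positive \<beta>" "\<beta> \<noteq> \<alpha> i"
  shows "positive (s i \<beta>)"
proof (rule ccontr)
  assume "\<not> positive (s i \<beta>)"
  then have neg: "positive (- s i \<beta>)"
    using root_sign reflection_root[OF simple_root assms(1)] by blast
  have zero: "\<beta> \<bullet> \<omega> j = 0" if "j \<noteq> i" for j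
  proof -
    have "s i \<beta> \<bullet> \<omega> j = \<beta> \<bullet> \<omega> j"
      using that by (simp add: inner_reflection inner_commute[of "\<alpha> _" "\<omega> _"] fundamental_weight_inner)
    moreover have "0 \<le> \<beta> \<bullet> \<omega> j" "0 \<le> (- s i \<beta>) \<bullet> \<omega> j"
      using assms(2) neg unfolding positive_def by blast+
    ultimately show ?thesis by simp
  qed
  define t where "t = 2 * (\<beta> \<bullet> \<omega> i) / (\<alpha> i \<bullet> \<alpha> i)"
  have "\<beta> = (\<Sum>j\<in>UNIV. if j = i then t *\<^sub>R \<alpha> i else 0)"
    by (subst simple_expansion[of \<beta>], rule sum.cong) (auto simp: zero t_def)
  then have t: "\<beta> = t *\<^sub>R \<alpha> i" by simp
  then have "t = 1 \<or> t = -1" using scale_root[OF simple_root] assms(1) by metis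
  moreover have "0 \<le> t" using assms(2) by (simp add: t_def positive_def)
  ultimately show False using t assms(3) by auto
qed

lemma simple_obtuse:
  assumes "i \<noteq> j" shows "\<alpha> i \<bullet> \<alpha> j \<le> 0"
proof -
  have "positive (s j (\<alpha> i))"
    using simple_reflection_positive[OF simple_root positive_simple] assms inj_simple
    by (metis injD)
  then have "0 \<le> s j (\<alpha> i) \<bullet> \<omega> j" by (simp add: positive_def)
  then show ?thesis
    using assms simple_inner_pos[of j]
    by (simp add: inner_reflection inner_commute[of "\<alpha> _" "\<omega> _"] fundamental_weight_inner)
qed

text \<open>The product of the simple reflections named by a word.\<close>

definition word :: "'n list \<Rightarrow> 'a \<Rightarrow> 'a" where "word is = foldr (\<lambda>i f. s i \<circ> f) is id"

lemma word_Nil [simp]: "word [] = id" and word_Cons [simp]: "word (i # is) = s i \<circ> word is"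
  by (simp_all add: word_def)

lemma word_append: "word (is @ js) = word is \<circ> word js"
  by (induction "is") (auto simp: fun_eq_iff)

lemma word_rev: "word (rev is) (word is v) = v"
  by (induction "is" arbitrary: v) (auto simp: word_append reflection_reflection)

lemma word_rev': "word is (word (rev is) v) = v"
  using word_rev[of "rev is"] by simp

lemma word_isometry: "word is v \<bullet> word is w = v \<bullet> w"
  by (induction "is") (auto simp: reflection_isometry)

lemma linear_word: "linear (word is)"
proof (induction "is")
  case Nil
  show ?case unfolding word_Nil by (rule linear_id)
next
  case (Cons i "is")
  show ?case unfolding word_Cons by (rule linear_compose[OF Cons linear_reflection])
qed

lemma word_root: "\<beta> \<in> \<Phi> \<Longrightarrow> word is \<beta> \<in> \<Phi>"
  by (induction "is") (auto simp: reflection_root simple_root)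

lemma word_reflection: "word is (reflection \<beta> v) = reflection (word is \<beta>) (word is v)"
  by (simp add: reflection_def linear_diff[OF linear_word] linear_scale[OF linear_word] word_isometry)

lemma finite_range_word: "finite (range word)"
proof -
  have "inj_on (\<lambda>f. restrict f \<Phi>) (range word)"
  proof (rule inj_onI, clarsimp)
    fix xs ys assume eq: "restrict (word xs) \<Phi> = restrict (word ys) \<Phi>"
    show "word xs = word ys"
    proof
      fix x
      have "word xs \<beta> = word ys \<beta>" if "\<beta> \<in> \<Phi>" for \<beta> using fun_cong[OF eq, of \<beta>] that by simp
      then show "word xs x = word ys x"
        using linear_eq_on_span[OF linear_word linear_word, of \<Phi>] span_roots by blast
    qed
  qed
  moreover have "(\<lambda>f. restrict f \<Phi>) ` range word \<subseteq> \<Phi> \<rightarrow>\<^sub>E \<Phi>"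
    using word_root by auto
  moreover have "finite (\<Phi> \<rightarrow>\<^sub>E \<Phi>)" using finite_roots by (rule finite_PiE) (simp add: finite_roots)
  ultimately show ?thesis by (meson finite_imageD finite_subset)
qed

text \<open>
  The sum of the fundamental weights; any strictly dominant vector would serve as well.
\<close>

definition \<rho> :: 'a where "\<rho> = (\<Sum>i\<in>UNIV. \<omega> i)"

lemma inner_rho: "\<alpha> i \<bullet> \<rho> > 0"
  using simple_inner_pos[of i]
  by (simp add: \<rho>_def inner_sum_right inner_commute[of "\<alpha> _" "\<omega> _"] fundamental_weight_inner)

text \<open>
  Among the positive roots in the orbit of \<open>\<beta>\<close> under the simple reflections, one that minimises the
  product with \<open>\<rho>\<close> is simple: it has a positive product with some \<open>\<alpha> k\<close>, and reflecting in \<open>\<alpha> k\<close> would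
  otherwise give a smaller positive root.
\<close>

lemma positive_root_conjugate_simple:
  assumes "\<beta> \<in> \<Phi>" "positive \<beta>"
  shows "\<exists>is k. \<beta> = word is (\<alpha> k)"
proof -
  let ?X = "{\<gamma>. \<gamma> \<in> \<Phi> \<and> positive \<gamma> \<and> (\<exists>is. \<gamma> = word is \<beta>)}"
  have fin: "finite ?X" using finite_roots by simp
  have "\<beta> = word [] \<beta>" by simp
  then have "\<beta> \<in> ?X" using assms by blast
  then have "?X \<noteq> {}" by blast
  then obtain \<gamma> where \<gamma>: "\<gamma> \<in> ?X" "\<And>\<delta>. \<delta> \<in> ?X \<Longrightarrow> \<gamma> \<bullet> \<rho> \<le> \<delta> \<bullet> \<rho>"
    using finite_maximiser[OF fin, of "\<lambda>x. - (x \<bullet> \<rho>)"] by auto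
  then obtain "is" where i: "\<gamma> = word is \<beta>" by blast
  have "\<gamma> \<noteq> 0" using \<gamma>(1) zero_not_root by auto
  then have pos: "\<gamma> \<bullet> \<gamma> > 0" by simp
  have "\<not> dominant (- \<gamma>)"
  proof
    assume "dominant (- \<gamma>)"
    then have "0 \<le> \<gamma> \<bullet> (- \<gamma>)" using positive_dominant_inner \<gamma>(1) by blast
    then show False using pos by simp
  qed
  then obtain k where k: "\<gamma> \<bullet> \<alpha> k > 0" by (auto simp: dominant_def not_le)
  have "s k \<gamma> \<bullet> \<rho> < \<gamma> \<bullet> \<rho>"
    using k inner_rho[of k] simple_inner_pos[of k] by (simp add: inner_reflection)
  then have "s k \<gamma> \<notin> ?X" using \<gamma>(2) by force
  moreover have "s k \<gamma> = word (k # is) \<beta>" by (simp add: i)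
  moreover have "s k \<gamma> \<in> \<Phi>" using \<gamma>(1) simple_root reflection_root by blast
  ultimately have "\<not> positive (s k \<gamma>)" by blast
  then have "\<gamma> = \<alpha> k" using simple_reflection_positive \<gamma>(1) by blast
  then have "\<beta> = word (rev is) (\<alpha> k)" using i word_rev by metis
  then show ?thesis by blast
qed

lemma reflection_uminus: "reflection (- \<beta>) = reflection \<beta>"
  by (auto simp: reflection_def fun_eq_iff)

lemma uminus_root: "\<beta> \<in> \<Phi> \<Longrightarrow> - \<beta> \<in> \<Phi>"
  using scale_root[of \<beta> "-1"] by simp

lemma reflection_eq_word:
  assumes "\<beta> \<in> \<Phi>" shows "\<exists>is. reflection \<beta> = word is"
proof -
  have *: "\<exists>is. reflection \<gamma> = word is" if \<gamma>: "\<gamma> \<in> \<Phi>" "positive \<gamma>" for \<gamma>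
  proof -
    obtain "is" k where "\<gamma> = word is (\<alpha> k)" using positive_root_conjugate_simple \<gamma> by blast
    then have "reflection \<gamma> v = word (is @ k # rev is) v" for v
      using word_reflection[of "is" "\<alpha> k" "word (rev is) v"] by (simp add: word_append word_rev')
    then show ?thesis by blast
  qed
  from root_sign[OF assms] show ?thesis
  proof
    assume "positive \<beta>"
    then show ?thesis using * assms by blast
  next
    assume "positive (- \<beta>)"
    then show ?thesis using *[OF uminus_root[OF assms]] by (simp add: reflection_uminus)
  qed
qed

lemma weyl_group_eq_words: "weyl_group \<Phi> = range word"
proof
  show "weyl_group \<Phi> \<subseteq> range word"
  proof
    fix w assume "w \<in> weyl_group \<Phi>"
    then show "w \<in> range word"
    proof induction
      case id
      then show ?case using word_Nil by (metis rangeI)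
    next
      case (reflection \<beta> w)
      obtain xs where "reflection \<beta> = word xs" using reflection_eq_word[OF reflection.hyps(1)] by blast
      moreover obtain ys where "w = word ys" using reflection.IH by blast
      ultimately have "reflection \<beta> \<circ> w = word (xs @ ys)" by (simp add: word_append)
      then show ?case by (rule range_eqI)
    qed
  qed
  have "word is \<in> weyl_group \<Phi>" for "is"
    by (induction "is") (simp_all only: word_Nil word_Cons weyl_group.intros simple_root)
  then show "range word \<subseteq> weyl_group \<Phi>" by blast
qed

text \<open>
  The exchange condition, in the form that a word followed by \<open>s k\<close> can be shortened whenever its
  value sends \<open>\<alpha> k\<close> to a negative root.
\<close>

lemma exchange:
  assumes "positive (- word is (\<alpha> k))"
  shows "\<exists>js. word is \<circ> s k = word js \<and> length js < length is"
  using assms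
proof (induction "is")
  case Nil
  then show ?case using positive_antisym positive_simple simple_nonzero by auto
next
  case (Cons i "is")
  show ?case
  proof (cases "positive (- word is (\<alpha> k))")
    case True
    then obtain js where "word is \<circ> s k = word js" "length js < length is" using Cons.IH by blast
    then show ?thesis by (intro exI[of _ "i # js"]) (auto simp: fun_eq_iff)
  next
    case False
    let ?\<gamma> = "word is (\<alpha> k)"
    have \<gamma>: "?\<gamma> \<in> \<Phi>" "positive ?\<gamma>"
      using False root_sign word_root simple_root by blast+
    have "\<not> positive (s i ?\<gamma>)"
      using Cons.prems positive_antisym[of "s i ?\<gamma>"] reflection_root[OF simple_root \<gamma>(1), of i] zero_not_root by auto
    then have "?\<gamma> = \<alpha> i" using simple_reflection_positive \<gamma> by blast
    \<comment> \<open>The reflection in the root \<open>word is (\<alpha> k) = \<alpha> i\<close> is the conjugate of \<open>s k\<close> by \<open>word is\<close>, so the first letter cancels.\<close>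
    then have "word (i # is) \<circ> s k = word is"
      by (auto simp: fun_eq_iff word_reflection reflection_reflection)
    then show ?thesis by (metis length_Cons lessI)
  qed
qed

text \<open>
  A dominant vector dominates its orbit in the root order.  By induction on the length of the word:
  a last letter \<open>k\<close> either subtracts a non-negative multiple of a positive root, or is absorbed by
  \<open>exchange\<close>.
\<close>

lemma dominant_minus_word_positive:
  assumes "dominant v" shows "positive (v - word is v)"
proof (induction "length is" arbitrary: "is" rule: less_induct)
  case less
  show ?case
  proof (cases "is" rule: rev_cases)
    case Nil
    then show ?thesis by (simp add: positive_def)
  next
    case (snoc js k)
    show ?thesis
    proof (cases "positive (word js (\<alpha> k))")
      case True
      define c where "c = 2 * (v \<bullet> \<alpha> k) / (\<alpha> k \<bullet> \<alpha> k)"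
      have "0 \<le> c" using assms by (simp add: c_def dominant_def)
      have "v - word is v = (v - word js v) + c *\<^sub>R word js (\<alpha> k)"
        by (simp add: snoc word_append reflection_def c_def linear_diff[OF linear_word]
              linear_scale[OF linear_word])
      moreover have "positive (v - word js v)" using less[of js] snoc by simp
      ultimately show ?thesis
        using positive_add positive_scale[OF \<open>0 \<le> c\<close> True] by metis
    next
      case False
      then have "positive (- word js (\<alpha> k))" using root_sign word_root simple_root by blast
      then obtain ks where "word is = word ks" "length ks < length js"
        using exchange[of js k] by (auto simp: snoc word_append)
      then show ?thesis using less[of ks] snoc by auto
    qed
  qed
qed

lemma dominant_unique:
  assumes "dominant v" "dominant (word is v)" shows "word is v = v"
proof -
  have "positive (v - word is v)" using dominant_minus_word_positive assms by blast
  moreover have "positive (- (v - word is v))"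
    using dominant_minus_word_positive[OF assms(2), of "rev is"] by (simp add: word_rev)
  ultimately show ?thesis using positive_antisym by fastforce
qed

lemma exists_dominant: "\<exists>is. dominant (word is v)"
proof -
  have fin: "finite ((\<lambda>w. w v) ` range word)" using finite_range_word by blast
  then obtain x where x: "x \<in> (\<lambda>w. w v) ` range word" "\<And>y. y \<in> (\<lambda>w. w v) ` range word \<Longrightarrow> y \<bullet> \<rho> \<le> x \<bullet> \<rho>"
    using finite_maximiser[OF fin, of "\<lambda>x. x \<bullet> \<rho>"] by auto
  then obtain "is" where i: "x = word is v" by blast
  have "0 \<le> x \<bullet> \<alpha> k" for k
  proof (rule ccontr)
    assume "\<not> 0 \<le> x \<bullet> \<alpha> k"
    then have "x \<bullet> \<rho> < s k x \<bullet> \<rho>"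
      using inner_rho[of k] simple_inner_pos[of k]
      by (auto simp: inner_reflection divide_simps mult_less_0_iff)
    moreover have "s k x \<in> (\<lambda>w. w v) ` range word"
    proof -
      have "s k x = word (k # is) v" by (simp add: i)
      then show ?thesis by blast
    qed
    ultimately show False using x(2) by force
  qed
  then show ?thesis using i by (auto simp: dominant_def)
qed

lemma weight_polytope_eq: "weight_polytope \<Phi> v = convex hull (range (\<lambda>is. word is v))"
  unfolding weight_polytope_def weyl_group_eq_words by (simp add: image_image)

lemma finite_orbit: "finite (range (\<lambda>is. word is v))"
  using finite_imageI[OF finite_range_word, of "\<lambda>w. w v"] by (simp add: image_image)

text \<open>
  For the converse direction, a hyperplane that separates \<open>x\<close> from the polytope can be moved by the
  group so that its normal vector becomes dominant, where \<open>v - x\<close> in the cone gives a contradiction.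
\<close>

lemma dominant_mem_weight_polytope:
  assumes "dominant v" "dominant x"
  shows "x \<in> weight_polytope \<Phi> v \<longleftrightarrow> positive (v - x)"
proof
  assume x: "x \<in> weight_polytope \<Phi> v"
  have "convex {x. positive (v - x)}"
  proof -
    have "{x. positive (v - x)} = (\<Inter>i. {x. \<omega> i \<bullet> x \<le> v \<bullet> \<omega> i})"
      by (auto simp: positive_def inner_diff_left inner_diff_right inner_commute[of _ "\<omega> _"])
    then show ?thesis by (auto intro: convex_INT convex_halfspace_le)
  qed
  then have "convex hull (range (\<lambda>is. word is v)) \<subseteq> {x. positive (v - x)}"
    by (intro hull_minimal) (use dominant_minus_word_positive[OF assms(1)] in auto)
  then show "positive (v - x)" using x weight_polytope_eq by auto
next
  assume pos: "positive (v - x)"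
  let ?P = "weight_polytope \<Phi> v"
  show "x \<in> ?P"
  proof (rule ccontr)
    assume "x \<notin> ?P"
    moreover have "closed ?P" "convex ?P"
      unfolding weight_polytope_eq using finite_orbit
      by (auto intro: compact_imp_closed finite_imp_compact_convex_hull)
    ultimately obtain a b where ab: "a \<bullet> x < b" "\<And>y. y \<in> ?P \<Longrightarrow> b < a \<bullet> y"
      using separating_hyperplane_closed_point[of ?P x] by blast
    \<comment> \<open>The outward normal of the separating hyperplane is \<open>- a\<close>.\<close>
    obtain "is" where d: "dominant (word is (- a))" using exists_dominant by blast
    let ?m = "word is (- a)"
    have "x \<bullet> (?m - word (rev is) ?m) \<ge> 0"
      using positive_dominant_inner[OF dominant_minus_word_positive[OF d] assms(2), of "rev is"]
      by (simp add: inner_commute)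
    then have "x \<bullet> (- a) \<le> x \<bullet> ?m" by (simp add: word_rev inner_add_right)
    also have "\<dots> \<le> v \<bullet> ?m"
      using positive_dominant_inner[OF pos d] by (simp add: inner_diff_left)
    also have "\<dots> = word (rev is) v \<bullet> (- a)"
      using word_isometry[of "rev is" v ?m] by (simp add: word_rev)
    finally have "word (rev is) v \<bullet> a \<le> x \<bullet> a" by simp
    moreover have "word (rev is) v \<in> ?P" unfolding weight_polytope_eq by (rule hull_inc) blast
    ultimately show False using ab by (force simp: inner_commute)
  qed
qed

lemma word_image_weight_polytope: "word is ` weight_polytope \<Phi> v = weight_polytope \<Phi> v"
proof -
  have "word is ` range (\<lambda>js. word js v) = range (\<lambda>js. word js v)"
  proof safe
    fix js show "word is (word js v) \<in> range (\<lambda>js. word js v)"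
      by (rule range_eqI[of _ _ "is @ js"]) (simp add: word_append)
  next
    fix js show "word js v \<in> word is ` range (\<lambda>js. word js v)"
      by (rule image_eqI[of _ _ "word (rev is @ js) v"]) (simp add: word_append word_rev', blast)
  qed
  then show ?thesis
    unfolding weight_polytope_eq by (simp add: convex_hull_linear_image[OF linear_word])
qed

lemma weight_polytope_Un:
  "weight_polytope \<Phi> v = (\<Union>w\<in>weyl_group \<Phi>. w ` {x \<in> weight_polytope \<Phi> v. dominant x})"
proof
  show "weight_polytope \<Phi> v \<subseteq> (\<Union>w\<in>weyl_group \<Phi>. w ` {x \<in> weight_polytope \<Phi> v. dominant x})"
  proof
    fix x assume x: "x \<in> weight_polytope \<Phi> v"
    obtain "is" where d: "dominant (word is x)" using exists_dominant by blast
    have "x = word (rev is) (word is x)" by (simp add: word_rev)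
    moreover have "word is x \<in> weight_polytope \<Phi> v" using x word_image_weight_polytope by blast
    ultimately show "x \<in> (\<Union>w\<in>weyl_group \<Phi>. w ` {x \<in> weight_polytope \<Phi> v. dominant x})"
      using d unfolding weyl_group_eq_words by blast
  qed
  show "(\<Union>w\<in>weyl_group \<Phi>. w ` {x \<in> weight_polytope \<Phi> v. dominant x}) \<subseteq> weight_polytope \<Phi> v"
    unfolding weyl_group_eq_words using word_image_weight_polytope by blast
qed

text \<open>
  Since an orbit has a single dominant member, a common point of two chambers is \<open>w x = w' x\<close> with
  \<open>x\<close> in the proper subspace on which \<open>w\<close> and \<open>w'\<close> agree.
\<close>

lemma negligible_chamber_overlap:
  assumes "w \<in> weyl_group \<Phi>" "w' \<in> weyl_group \<Phi>" "w \<noteq> w'"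
  shows "negligible (w ` {x. dominant x} \<inter> w' ` {x. dominant x})"
proof -
  obtain xs ys where w: "w = word xs" "w' = word ys" using assms weyl_group_eq_words by auto
  let ?S = "{x. w x = w' x}"
  have sub: "w ` {x. dominant x} \<inter> w' ` {x. dominant x} \<subseteq> w ` ?S"
  proof clarify
    fix x y assume xy: "dominant x" "dominant y" "w x = w' y"
    then have "y = word (rev ys @ xs) x" by (metis comp_apply w word_append word_rev)
    then have "y = x" using dominant_unique xy by metis
    then show "w x \<in> w ` ?S" using xy by auto
  qed
  have lin: "linear w" "linear w'" using w linear_word by auto
  have "subspace ?S" using lin
    by (auto simp: subspace_def linear_0 linear_add linear_scale)
  moreover have "?S \<noteq> UNIV" using assms(3) by auto
  ultimately have "dim ?S < DIM('a)"
    by (metis dim_eq_full dim_subset_UNIV le_neq_implies_less span_eq_iff)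
  then have "dim (w ` ?S) < DIM('a)" using dim_image_le[OF lin(1), of ?S] by linarith
  then show ?thesis using negligible_lowdim negligible_subset sub by blast
qed

end

section \<open>Principal inverses and commuting subset matrices\<close>

text \<open>
  \<open>D\<close> is the inverse of the submatrix of \<open>C\<close> on \<open>K \<times> K\<close>, extended by 0; this is the property that
  \<^const>\<open>principal_inverse\<close> selects.
\<close>

definition is_principal_inverse :: "real ^ 'n ^ 'n \<Rightarrow> 'n::finite set \<Rightarrow> real ^ 'n ^ 'n \<Rightarrow> bool" where
  "is_principal_inverse C K D \<longleftrightarrow>
     (\<forall>i j. i \<notin> K \<or> j \<notin> K \<longrightarrow> D $ i $ j = 0) \<and>
     (\<forall>i\<in>K. \<forall>j\<in>K.
        (\<Sum>k\<in>K. C $ i $ k * D $ k $ j) = (if i = j then 1 else 0) \<and>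
        (\<Sum>k\<in>K. D $ i $ k * C $ k $ j) = (if i = j then 1 else 0))"

lemma is_principal_inverse_unique:
  assumes "is_principal_inverse C K D" "is_principal_inverse C K E"
  shows "D = E"
proof -
  have "D $ i $ j = E $ i $ j" for i j
  proof (cases "i \<in> K \<and> j \<in> K")
    case True
    have "D $ i $ j = (\<Sum>k\<in>K. D $ i $ k * (\<Sum>l\<in>K. C $ k $ l * E $ l $ j))"
    proof -
      have "(\<Sum>l\<in>K. C $ k $ l * E $ l $ j) = (if k = j then 1 else 0)" if "k \<in> K" for k
        using assms(2) True that unfolding is_principal_inverse_def by blast
      then have "(\<Sum>k\<in>K. D $ i $ k * (\<Sum>l\<in>K. C $ k $ l * E $ l $ j)) = (\<Sum>k\<in>K. D $ i $ k * (if k = j then 1 else 0))"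
        by (intro sum.cong) auto
      then show ?thesis using True by (simp add: if_distrib cong: if_cong)
    qed
    also have "\<dots> = (\<Sum>l\<in>K. (\<Sum>k\<in>K. D $ i $ k * C $ k $ l) * E $ l $ j)"
      by (simp add: sum_distrib_left sum_distrib_right mult.assoc) (rule sum.swap)
    also have "\<dots> = (\<Sum>l\<in>K. (if i = l then 1 else 0) * E $ l $ j)"
    proof (rule sum.cong[OF refl])
      fix l assume "l \<in> K"
      then have "(\<Sum>k\<in>K. D $ i $ k * C $ k $ l) = (if i = l then 1 else 0)"
        using assms(1) True unfolding is_principal_inverse_def by blast
      then show "(\<Sum>k\<in>K. D $ i $ k * C $ k $ l) * E $ l $ j = (if i = l then 1 else 0) * E $ l $ j" by simp
    qed
    also have "\<dots> = E $ i $ j"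
      using True by (simp add: if_distrib[of "\<lambda>x. x * _"] cong: if_cong)
    finally show ?thesis .
  next
    case False
    then show ?thesis using assms unfolding is_principal_inverse_def by auto
  qed
  then show ?thesis by (simp add: vec_eq_iff)
qed

lemma principal_inverse_eqI:
  assumes "is_principal_inverse C K D" shows "principal_inverse C K = D"
  using assms is_principal_inverse_unique[of C K]
  unfolding principal_inverse_def is_principal_inverse_def by (intro the_equality) blast+

text \<open>
  \<^const>\<open>subset_matrix\<close> for an arbitrary matrix in place of the Cartan matrix.
\<close>

definition step_matrix :: "real ^ 'n ^ 'n \<Rightarrow> 'n::finite \<Rightarrow> real ^ ('n set) ^ ('n set)" where
  "step_matrix C i = (\<chi> J K.
     if i \<in> K \<and> card K = card J + 1 \<and> is_singleton (K - J)
     then (let s = the_elem (K - J); D = principal_inverse C K in D $ i $ s / D $ s $ s)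
     else 0)"

lemma subset_matrix_eq: "subset_matrix \<alpha> = step_matrix (cartan_matrix \<alpha>)"
  by (simp add: subset_matrix_def step_matrix_def fun_eq_iff)

text \<open>
  The right-hand side is symmetric under exchanging \<open>(x, y)\<close> with \<open>(z, w)\<close>, which is what makes two
  subset matrices commute.
\<close>

lemma two_by_two_minor_identity:
  fixes a b p q x y z w :: real
  assumes "a \<noteq> 0" "b \<noteq> 0" "a * b - p * q \<noteq> 0"
  shows "(x - y * q / b) / (a - p * q / b) * (w / b) + (y - x * p / a) / (b - q * p / a) * (z / a)
    = (x * w + y * z - y * w * q / b - x * z * p / a) / (a * b - p * q)"
proof -
  have "(x - y * q / b) / (a - p * q / b) = (x * b - y * q) / (a * b - p * q)"
    using assms by (simp add: field_simps)
  moreover have "(y - x * p / a) / (b - q * p / a) = (y * a - x * p) / (a * b - p * q)"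
    using assms by (simp add: field_simps)
  ultimately have "(x - y * q / b) / (a - p * q / b) * (w / b) + (y - x * p / a) / (b - q * p / a) * (z / a)
     = ((x * b - y * q) * (w / b) + (y * a - x * p) * (z / a)) / (a * b - p * q)"
    by (simp add: add_divide_distrib mult.commute)
  also have "(x * b - y * q) * (w / b) + (y * a - x * p) * (z / a)
     = x * w + y * z - y * w * q / b - x * z * p / a"
    using assms by (simp add: field_simps)
  finally show ?thesis .
qed

text \<open>
  All that the volume computation needs of a Cartan matrix: every principal submatrix is invertible
  with a non-negative inverse that has a positive diagonal, and the off-diagonal entries are
  non-positive.
\<close>

locale inverse_positive =
  fixes C :: "real ^ 'n ^ 'n::finite"
  assumes principal_inverse: "is_principal_inverse C K (principal_inverse C K)"
    and offdiag: "i \<noteq> j \<Longrightarrow> C $ i $ j \<le> 0"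
    and inverse_nonneg: "0 \<le> principal_inverse C K $ i $ j"
    and inverse_diag_pos: "i \<in> K \<Longrightarrow> 0 < principal_inverse C K $ i $ i"
begin

abbreviation D :: "'n set \<Rightarrow> real ^ 'n ^ 'n" where "D \<equiv> principal_inverse C"
abbreviation M :: "'n \<Rightarrow> real ^ ('n set) ^ ('n set)" where "M \<equiv> step_matrix C"

lemma inverse_outside: "i \<notin> K \<or> j \<notin> K \<Longrightarrow> D K $ i $ j = 0"
  using principal_inverse[of K] unfolding is_principal_inverse_def by blast

lemma inverse_right: "i \<in> K \<Longrightarrow> j \<in> K \<Longrightarrow> (\<Sum>k\<in>K. C $ i $ k * D K $ k $ j) = (if i = j then 1 else 0)"
  and inverse_left: "i \<in> K \<Longrightarrow> j \<in> K \<Longrightarrow> (\<Sum>k\<in>K. D K $ i $ k * C $ k $ j) = (if i = j then 1 else 0)"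
  using principal_inverse[of K] unfolding is_principal_inverse_def by blast+

text \<open>
  Removing an index from \<open>K\<close> replaces the inverse by a Schur complement.
\<close>

lemma inverse_schur:
  assumes "s \<in> K"
  shows "D (K - {s}) $ i $ t = D K $ i $ t - D K $ i $ s * D K $ s $ t / D K $ s $ s"
proof -
  have nz: "D K $ s $ s \<noteq> 0" using inverse_diag_pos[OF assms] by simp
  let ?E = "(\<chi> i t. D K $ i $ t - D K $ i $ s * D K $ s $ t / D K $ s $ s) :: real ^ 'n ^ 'n"
  have "is_principal_inverse C (K - {s}) ?E"
    unfolding is_principal_inverse_def
  proof (intro conjI allI ballI impI)
    fix i j assume "i \<notin> K - {s} \<or> j \<notin> K - {s}"
    then show "?E $ i $ j = 0" using nz inverse_outside by auto
  next
    fix i j assume ij: "i \<in> K - {s}" "j \<in> K - {s}"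
    have "(\<Sum>k\<in>K - {s}. C $ i $ k * ?E $ k $ j) = (\<Sum>k\<in>K. C $ i $ k * ?E $ k $ j)"
      using nz by (intro sum.mono_neutral_left) auto
    also have "\<dots> = (\<Sum>k\<in>K. C $ i $ k * D K $ k $ j) - (\<Sum>k\<in>K. C $ i $ k * D K $ k $ s) * (D K $ s $ j / D K $ s $ s)"
      by (simp add: right_diff_distrib sum_subtractf sum_distrib_right sum_divide_distrib mult.assoc)
    also have "\<dots> = (if i = j then 1 else 0)" using ij assms by (simp add: inverse_right)
    finally show "(\<Sum>k\<in>K - {s}. C $ i $ k * ?E $ k $ j) = (if i = j then 1 else 0)" .
    have "(\<Sum>k\<in>K - {s}. ?E $ i $ k * C $ k $ j) = (\<Sum>k\<in>K. ?E $ i $ k * C $ k $ j)"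
      using nz by (intro sum.mono_neutral_left) auto
    also have "\<dots> = (\<Sum>k\<in>K. D K $ i $ k * C $ k $ j) - (D K $ i $ s / D K $ s $ s) * (\<Sum>k\<in>K. D K $ s $ k * C $ k $ j)"
      by (simp add: left_diff_distrib sum_subtractf sum_distrib_left sum_divide_distrib mult.assoc)
    also have "\<dots> = (if i = j then 1 else 0)" using ij assms by (auto simp: inverse_left)
    finally show "(\<Sum>k\<in>K - {s}. ?E $ i $ k * C $ k $ j) = (if i = j then 1 else 0)" .
  qed
  from principal_inverse_eqI[OF this] show ?thesis by simp
qed

text \<open>
  The only possibly non-zero entries of column \<open>K\<close> are in the rows \<open>K - {s}\<close> with \<open>s \<in> K\<close>.  For
  \<open>i \<notin> K\<close> both sides are 0.
\<close>

lemma step_matrix_remove: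
  assumes "s \<in> K" shows "M i $ (K - {s}) $ K = D K $ i $ s / D K $ s $ s"
proof -
  have "K - (K - {s}) = {s}" using assms by blast
  moreover have "card K = card (K - {s}) + 1" using assms card_Suc_Diff1[of K s] by simp
  ultimately show ?thesis using inverse_outside[of i K s] by (auto simp: step_matrix_def Let_def)
qed

lemma step_matrix_eq_0:
  assumes "\<And>s. s \<in> K \<Longrightarrow> J \<noteq> K - {s}" shows "M i $ J $ K = 0"
proof (rule ccontr)
  assume "M i $ J $ K \<noteq> 0"
  then have *: "card K = card J + 1" "is_singleton (K - J)"
    by (auto simp: step_matrix_def split: if_splits)
  then obtain s where s: "K - J = {s}" by (auto elim: is_singletonE)
  have "card K = card (K \<inter> J) + card (K - J)" by (simp add: card_Int_Diff)
  then have "card (K \<inter> J) = card J" using * s by simp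
  then have "K \<inter> J = J" by (intro card_subset_eq) auto
  then have "J = K - {s}" using s by blast
  then show False using assms[of s] s by blast
qed

lemma sum_step_matrix:
  "(\<Sum>J\<in>UNIV. x J * M i $ J $ K) = (\<Sum>s\<in>K. x (K - {s}) * (D K $ i $ s / D K $ s $ s))"
proof -
  have "(\<Sum>J\<in>UNIV. x J * M i $ J $ K) = (\<Sum>J\<in>(\<lambda>s. K - {s}) ` K. x J * M i $ J $ K)"
  proof (rule sum.mono_neutral_right)
    show "\<forall>J\<in>UNIV - (\<lambda>s. K - {s}) ` K. x J * M i $ J $ K = 0"
    proof
      fix J assume "J \<in> UNIV - (\<lambda>s. K - {s}) ` K"
      then have "M i $ J $ K = 0" by (intro step_matrix_eq_0) blast
      then show "x J * M i $ J $ K = 0" by simp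
    qed
  qed auto
  also have "\<dots> = (\<Sum>s\<in>K. x (K - {s}) * M i $ (K - {s}) $ K)"
    by (rule sum.reindex_cong[of "\<lambda>s. K - {s}"]) (auto simp: inj_on_def)
  also have "\<dots> = (\<Sum>s\<in>K. x (K - {s}) * (D K $ i $ s / D K $ s $ s))"
    by (rule sum.cong) (simp_all add: step_matrix_remove)
  finally show ?thesis .
qed

lemma step_matrix_mult_remove2:
  assumes "s \<in> K" "t \<in> K" "s \<noteq> t"
  shows "(M i ** M j) $ (K - {s, t}) $ K =
    D (K - {t}) $ i $ s / D (K - {t}) $ s $ s * (D K $ j $ t / D K $ t $ t) +
    D (K - {s}) $ i $ t / D (K - {s}) $ t $ t * (D K $ j $ s / D K $ s $ s)"
proof -
  let ?J = "K - {s, t}"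
  have J: "?J = (K - {s}) - {t}" "?J = (K - {t}) - {s}" by auto
  have "(M i ** M j) $ ?J $ K = (\<Sum>r\<in>K. M i $ ?J $ (K - {r}) * (D K $ j $ r / D K $ r $ r))"
    by (simp add: matrix_matrix_mult_def sum_step_matrix)
  also have "\<dots> = (\<Sum>r\<in>{s, t}. M i $ ?J $ (K - {r}) * (D K $ j $ r / D K $ r $ r))"
  proof (rule sum.mono_neutral_right)
    show "\<forall>r\<in>K - {s, t}. M i $ ?J $ (K - {r}) * (D K $ j $ r / D K $ r $ r) = 0"
    proof
      fix r assume r: "r \<in> K - {s, t}"
      have "?J \<noteq> K - {r} - {q}" for q using r by auto
      then show "M i $ ?J $ (K - {r}) * (D K $ j $ r / D K $ r $ r) = 0"
        using step_matrix_eq_0 by simp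
    qed
  qed (use assms in auto)
  also have "\<dots> = M i $ ?J $ (K - {t}) * (D K $ j $ t / D K $ t $ t)
      + M i $ ?J $ (K - {s}) * (D K $ j $ s / D K $ s $ s)"
    using assms by simp
  also have "M i $ ?J $ (K - {t}) = D (K - {t}) $ i $ s / D (K - {t}) $ s $ s"
    unfolding J(2) by (rule step_matrix_remove) (use assms in auto)
  also have "M i $ ?J $ (K - {s}) = D (K - {s}) $ i $ t / D (K - {s}) $ t $ t"
    unfolding J(1) by (rule step_matrix_remove) (use assms in auto)
  finally show ?thesis .
qed

lemma step_matrix_mult_eq_0:
  assumes "\<And>s t. s \<in> K \<Longrightarrow> t \<in> K \<Longrightarrow> s \<noteq> t \<Longrightarrow> J \<noteq> K - {s, t}"
  shows "(M i ** M j) $ J $ K = 0"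
proof -
  have "M i $ J $ (K - {r}) = 0" if r: "r \<in> K" for r
  proof (rule step_matrix_eq_0)
    fix q assume "q \<in> K - {r}"
    then have "J \<noteq> K - {r, q}" using r by (intro assms) auto
    moreover have "K - {r, q} = K - {r} - {q}" by blast
    ultimately show "J \<noteq> K - {r} - {q}" by simp
  qed
  then show ?thesis by (simp add: matrix_matrix_mult_def sum_step_matrix)
qed

text \<open>
  An entry of the product is non-zero only in a row \<open>K - {s, t}\<close>, where it is a sum over the two orders
  of removing \<open>s\<close> and \<open>t\<close>.
\<close>

lemma step_matrix_commute: "M i ** M j = M j ** M i"
proof -
  have "(M i ** M j) $ J $ K = (M j ** M i) $ J $ K" for J K
  proof (cases "\<exists>s t. s \<in> K \<and> t \<in> K \<and> s \<noteq> t \<and> J = K - {s, t}")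
    case True
    then obtain s t where st: "s \<in> K" "t \<in> K" "s \<noteq> t" "J = K - {s, t}" by blast
    have pos: "D K $ s $ s > 0" "D K $ t $ t > 0" using inverse_diag_pos st by auto
    have "D (K - {t}) $ s $ s > 0" using inverse_diag_pos st by auto
    then have "D K $ s $ s * D K $ t $ t - D K $ s $ t * D K $ t $ s > 0"
      using pos st by (simp add: inverse_schur field_simps)
    then have nz: "D K $ s $ s * D K $ t $ t - D K $ s $ t * D K $ t $ s \<noteq> 0" by simp
    have "(M i ** M j) $ J $ K =
      (D K $ i $ s * D K $ j $ t + D K $ i $ t * D K $ j $ s - D K $ i $ t * D K $ j $ t * D K $ t $ s / D K $ t $ t
       - D K $ i $ s * D K $ j $ s * D K $ s $ t / D K $ s $ s) / (D K $ s $ s * D K $ t $ t - D K $ s $ t * D K $ t $ s)" for i j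
      unfolding st(4) step_matrix_mult_remove2[OF st(1-3)] inverse_schur[OF st(1)] inverse_schur[OF st(2)]
      by (rule two_by_two_minor_identity) (use pos nz in auto)
    then show ?thesis by (simp add: algebra_simps)
  next
    case False
    then show ?thesis using step_matrix_mult_eq_0[of K J i j] step_matrix_mult_eq_0[of K J j i] by metis
  qed
  then show ?thesis by (simp add: vec_eq_iff)
qed

end

section \<open>Ordered products and the volume polynomial\<close>

lemma matrix_power_0 [simp]: "matrix_power A 0 = mat 1"
  and matrix_power_Suc: "matrix_power A (Suc k) = A ** matrix_power A k"
  by (simp_all add: matrix_power_def)

lemma matrix_power_commute:
  assumes "A ** B = B ** A" shows "matrix_power A k ** B = B ** matrix_power A k"
proof (induction k)
  case (Suc k)
  then have "matrix_power A (Suc k) ** B = A ** B ** matrix_power A k"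
    by (simp add: matrix_power_Suc flip: matrix_mul_assoc)
  then show ?case by (simp add: assms matrix_power_Suc matrix_mul_assoc)
qed simp

text \<open>
  The product behind \<^const>\<open>ordered_product\<close>, over an arbitrary list of indices.
\<close>

abbreviation list_product :: "('n \<Rightarrow> real ^ 'm ^ ('m::finite)) \<Rightarrow> 'n list \<Rightarrow> ('n \<Rightarrow> nat) \<Rightarrow> real ^ 'm ^ 'm" where
  "list_product M xs c \<equiv> foldr (\<lambda>i X. matrix_power (M i) (c i) ** X) xs (mat 1)"

context
  fixes M :: "'n \<Rightarrow> real ^ 'm ^ ('m::finite)"
  assumes comm: "M i ** M j = M j ** M i"
begin

lemma list_product_commute: "list_product M xs c ** M j = M j ** list_product M xs c"
proof (induction xs)
  case (Cons i xs)
  let ?P = "matrix_power (M i) (c i)" and ?L = "list_product M xs c"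
  have "?P ** ?L ** M j = ?P ** M j ** ?L"
    using Cons by (simp flip: matrix_mul_assoc)
  also have "?P ** M j = M j ** ?P" by (rule matrix_power_commute[OF comm])
  finally show ?case by (simp add: matrix_mul_assoc)
qed simp

lemma list_product_upd: "j \<notin> set xs \<Longrightarrow> list_product M xs (c(j := k)) = list_product M xs c"
  by (induction xs) auto

lemma list_product_Suc:
  "distinct xs \<Longrightarrow> j \<in> set xs \<Longrightarrow> list_product M xs (c(j := Suc (c j))) = list_product M xs c ** M j"
proof (induction xs)
  case (Cons i xs)
  show ?case
  proof (cases "i = j")
    case True
    then have "list_product M xs (c(j := Suc (c j))) = list_product M xs c"
      using Cons.prems by (intro list_product_upd) auto
    then have "list_product M (i # xs) (c(j := Suc (c j))) = M j ** matrix_power (M j) (c j) ** list_product M xs c"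
      using True by (simp add: matrix_power_Suc)
    also have "M j ** matrix_power (M j) (c j) = matrix_power (M j) (c j) ** M j"
      by (rule matrix_power_commute[OF refl, symmetric])
    also have "matrix_power (M j) (c j) ** M j ** list_product M xs c = list_product M (i # xs) c ** M j"
      using True list_product_commute[of c xs j] by (simp flip: matrix_mul_assoc)
    finally show ?thesis .
  next
    case False
    then show ?thesis using Cons by (simp add: matrix_mul_assoc)
  qed
qed simp

end

lemma ordered_product_Suc:
  fixes M :: "'n::{finite,linorder} \<Rightarrow> real ^ 'm ^ ('m::finite)"
  assumes "\<And>i j. M i ** M j = M j ** M i"
  shows "ordered_product M (c(j := Suc (c j))) = ordered_product M c ** M j"
  unfolding ordered_product_def using assms by (intro list_product_Suc) auto

lemma ordered_product_0: "ordered_product M (\<lambda>_. 0) = mat 1"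
proof -
  have "foldr (\<lambda>i X. matrix_power (M i) 0 ** X) xs (mat 1) = mat 1" for xs
    by (induction xs) auto
  then show ?thesis by (simp add: ordered_product_def)
qed

text \<open>
  The monomial of exponent vector \<open>c\<close> with divided powers.
\<close>

definition monomial :: "('n::finite \<Rightarrow> nat) \<Rightarrow> ('n \<Rightarrow> real) \<Rightarrow> real" where
  "monomial c u = (\<Prod>i\<in>UNIV. u i ^ c i / fact (c i))"

text \<open>
  The exponent vectors of total degree \<open>k\<close>.
\<close>

definition exponents :: "nat \<Rightarrow> ('n::finite \<Rightarrow> nat) set" where
  "exponents k = {c. (\<Sum>i\<in>UNIV. c i) = k}"

lemma finite_exponents: "finite (exponents k :: ('n::finite \<Rightarrow> nat) set)"
proof -
  have "exponents k \<subseteq> (UNIV :: 'n set) \<rightarrow>\<^sub>E {..k}"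
    by (auto simp: exponents_def member_le_sum)
  then show ?thesis by (rule finite_subset) (auto intro: finite_PiE)
qed

lemma monomial_upd: "u i * monomial c u = real (Suc (c i)) * monomial (c(i := Suc (c i))) u"
proof -
  have "monomial d u = u i ^ d i / fact (d i) * (\<Prod>j\<in>UNIV - {i}. u j ^ d j / fact (d j))" for d
    unfolding monomial_def by (rule prod.remove) auto
  note this[of c] this[of "c(i := Suc (c i))"]
  moreover have "(\<Prod>j\<in>UNIV - {i}. u j ^ (c(i := Suc (c i))) j / fact ((c(i := Suc (c i))) j))
     = (\<Prod>j\<in>UNIV - {i}. u j ^ c j / fact (c j))"
    by (rule prod.cong) auto
  ultimately have
    c: "monomial c u = u i ^ c i / fact (c i) * (\<Prod>j\<in>UNIV - {i}. u j ^ c j / fact (c j))" and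
    c': "monomial (c(i := Suc (c i))) u = u i * u i ^ c i / (real (Suc (c i)) * fact (c i)) *
      (\<Prod>j\<in>UNIV - {i}. u j ^ c j / fact (c j))"
    by simp_all
  show ?thesis unfolding c c' by simp
qed

lemma sum_exponents_Suc:
  fixes f :: "('n::finite \<Rightarrow> nat) \<Rightarrow> real"
  shows "(\<Sum>c\<in>exponents (Suc k). real (c i) * f c) =
    (\<Sum>c\<in>exponents k. real (Suc (c i)) * f (c(i := Suc (c i))))"
proof -
  have "(\<Sum>c\<in>exponents (Suc k). real (c i) * f c) =
        (\<Sum>c | c \<in> exponents (Suc k) \<and> c i > 0. real (c i) * f c)"
    using finite_exponents by (intro sum.mono_neutral_right) auto
  also have "\<dots> = (\<Sum>c\<in>exponents k. real (Suc (c i)) * f (c(i := Suc (c i))))"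
  proof (rule sum.reindex_bij_witness[of _ "\<lambda>c. c(i := Suc (c i))" "\<lambda>c. c(i := c i - 1)"])
    fix c :: "'n \<Rightarrow> nat" assume c: "c \<in> {c \<in> exponents (Suc k). 0 < c i}"
    have "(\<Sum>j\<in>UNIV. d j) = d i + (\<Sum>j\<in>UNIV - {i}. d j)" for d :: "'n \<Rightarrow> nat"
      by (rule sum.remove) auto
    note this[of c] this[of "c(i := c i - 1)"]
    then show "c(i := c i - 1) \<in> exponents k" using c by (simp add: exponents_def)
  next
    fix c :: "'n \<Rightarrow> nat" assume c: "c \<in> exponents k"
    have "(\<Sum>j\<in>UNIV. d j) = d i + (\<Sum>j\<in>UNIV - {i}. d j)" for d :: "'n \<Rightarrow> nat"
      by (rule sum.remove) auto
    note this[of c] this[of "c(i := Suc (c i))"]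
    then show "c(i := Suc (c i)) \<in> {c \<in> exponents (Suc k). 0 < c i}" using c by (simp add: exponents_def)
  qed auto
  finally show ?thesis .
qed

locale ordered_inverse_positive = inverse_positive C for C :: "real ^ 'n::{finite,linorder} ^ 'n::{finite,linorder}"
begin

text \<open>
  The polynomial of degree \<open>card K\<close> whose coefficients are the entries in row \<open>{}\<close> and column \<open>K\<close> of
  the products of subset matrices.
\<close>

definition volume_poly :: "'n set \<Rightarrow> ('n \<Rightarrow> real) \<Rightarrow> real" where
  "volume_poly K u = (\<Sum>c\<in>exponents (card K). ordered_product M c $ {} $ K * monomial c u)"

lemma volume_poly_empty: "volume_poly {} u = 1"
proof -
  have "exponents 0 = {\<lambda>_::'n. 0}" by (auto simp: exponents_def)
  then show ?thesis by (simp add: volume_poly_def ordered_product_0 monomial_def mat_def)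
qed

text \<open>
  Multiplying by \<open>card K\<close> and splitting \<open>card K\<close> as the sum of the exponents turns the left-hand side into
  a sum over \<open>i\<close> in which one factor \<open>M i\<close> can be moved to the right end of the product, by commutativity.
\<close>

lemma volume_poly_rec:
  assumes "K \<noteq> {}"
  shows "real (card K) * volume_poly K u =
    (\<Sum>s\<in>K. (\<Sum>i\<in>K. u i * D K $ i $ s) / D K $ s $ s * volume_poly (K - {s}) u)"
proof -
  define k where "k = card K - 1"
  have k: "card K = Suc k" using assms by (simp add: k_def card_gt_0_iff)
  let ?P = "\<lambda>c. ordered_product M c $ {}"
  have "(\<Sum>s\<in>K. (\<Sum>i\<in>K. u i * D K $ i $ s) / D K $ s $ s * volume_poly (K - {s}) u)
     = (\<Sum>s\<in>K. \<Sum>i\<in>UNIV. \<Sum>c\<in>exponents k. u i * monomial c u * (?P c $ (K - {s}) * (D K $ i $ s / D K $ s $ s)))"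
  proof (rule sum.cong[OF refl])
    fix s assume s: "s \<in> K"
    have *: "(\<Sum>i\<in>K. u i * D K $ i $ s) = (\<Sum>i\<in>UNIV. u i * D K $ i $ s)"
      by (intro sum.mono_neutral_left) (auto simp: inverse_outside)
    have "card (K - {s}) = k" using s k by simp
    then show "(\<Sum>i\<in>K. u i * D K $ i $ s) / D K $ s $ s * volume_poly (K - {s}) u
     = (\<Sum>i\<in>UNIV. \<Sum>c\<in>exponents k. u i * monomial c u * (?P c $ (K - {s}) * (D K $ i $ s / D K $ s $ s)))"
      unfolding * volume_poly_def
      by (simp add: sum_divide_distrib sum_product mult_ac) (rule sum.swap)
  qed
  also have "\<dots> = (\<Sum>i\<in>UNIV. \<Sum>c\<in>exponents k. u i * monomial c u * (\<Sum>s\<in>K. ?P c $ (K - {s}) * (D K $ i $ s / D K $ s $ s)))"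
  proof (subst sum.swap, rule sum.cong[OF refl])
    fix i
    show "(\<Sum>s\<in>K. \<Sum>c\<in>exponents k. u i * monomial c u * (?P c $ (K - {s}) * (D K $ i $ s / D K $ s $ s))) =
      (\<Sum>c\<in>exponents k. u i * monomial c u * (\<Sum>s\<in>K. ?P c $ (K - {s}) * (D K $ i $ s / D K $ s $ s)))"
      unfolding sum_distrib_left by (rule sum.swap)
  qed
  also have "\<dots> = (\<Sum>i\<in>UNIV. \<Sum>c\<in>exponents k. u i * monomial c u * ?P (c(i := Suc (c i))) $ K)"
  proof -
    have "?P (c(i := Suc (c i))) $ K = (\<Sum>s\<in>K. ?P c $ (K - {s}) * (D K $ i $ s / D K $ s $ s))" for c i
      unfolding ordered_product_Suc[of M, OF step_matrix_commute] by (simp add: matrix_matrix_mult_def sum_step_matrix)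
    then show ?thesis by (simp only:)
  qed
  also have "\<dots> = (\<Sum>i\<in>UNIV. \<Sum>c\<in>exponents k. real (Suc (c i)) * (monomial (c(i := Suc (c i))) u * ?P (c(i := Suc (c i))) $ K))"
    by (simp only: monomial_upd mult.assoc)
  also have "\<dots> = (\<Sum>i\<in>UNIV. \<Sum>c\<in>exponents (Suc k). real (c i) * (monomial c u * ?P c $ K))"
    by (simp only: sum_exponents_Suc)
  also have "\<dots> = (\<Sum>c\<in>exponents (Suc k). (\<Sum>i\<in>UNIV. real (c i)) * (monomial c u * ?P c $ K))"
    by (subst sum.swap) (simp add: sum_distrib_right)
  also have "\<dots> = (\<Sum>c\<in>exponents (Suc k). real (Suc k) * (monomial c u * ?P c $ K))"
    by (rule sum.cong) (auto simp: exponents_def simp flip: of_nat_sum)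
  also have "\<dots> = real (card K) * volume_poly K u"
    by (simp add: volume_poly_def k sum_distrib_left mult_ac)
  finally show ?thesis by simp
qed

end


lemma digits_unique:
  fixes f g :: "nat \<Rightarrow> nat"
  assumes "\<And>j. j < n \<Longrightarrow> f j < N" "\<And>j. j < n \<Longrightarrow> g j < N"
    and "(\<Sum>j<n. f j * N ^ j) = (\<Sum>j<n. g j * N ^ j)" "j < n"
  shows "f j = g j"
  using assms
proof (induction n arbitrary: f g j)
  case (Suc n)
  have split: "(\<Sum>j<Suc n. h j * N ^ j) = h 0 + N * (\<Sum>j<n. h (Suc j) * N ^ j)" for h :: "nat \<Rightarrow> nat"
    by (simp add: sum.lessThan_Suc_shift sum_distrib_left mult_ac del: sum.lessThan_Suc)
  have eq: "f 0 + N * (\<Sum>j<n. f (Suc j) * N ^ j) = g 0 + N * (\<Sum>j<n. g (Suc j) * N ^ j)"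
    using Suc.prems(3) unfolding split .
  have lt: "f 0 < N" "g 0 < N" using Suc.prems(1,2) by auto
  have "f 0 = (f 0 + N * (\<Sum>j<n. f (Suc j) * N ^ j)) mod N" using lt by simp
  also have "\<dots> = g 0" unfolding eq using lt by simp
  finally have 0: "f 0 = g 0" .
  then have "(\<Sum>j<n. f (Suc j) * N ^ j) = (\<Sum>j<n. g (Suc j) * N ^ j)" using eq lt by simp
  then have "f (Suc i) = g (Suc i)" if "i < n" for i
    using Suc.IH[of "\<lambda>j. f (Suc j)" "\<lambda>j. g (Suc j)" i] Suc.prems(1,2) that by simp
  then show ?case using 0 Suc.prems(4) by (cases j) auto
qed simp

text \<open>
  Kronecker substitution: with \<open>x\<close> raised to distinct powers of \<open>k + 1\<close> in place of the variables,
  distinct exponent vectors give distinct powers of \<open>x\<close>, and a polynomial in one variable with infinitely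
  many roots vanishes.
\<close>

lemma monomial_coefficients_eq_0:
  fixes a :: "('n::finite \<Rightarrow> nat) \<Rightarrow> real"
  assumes zero: "\<And>u. (\<And>i. 0 \<le> u i) \<Longrightarrow> (\<Sum>c\<in>exponents k. a c * monomial c u) = 0"
    and d: "d \<in> exponents k"
  shows "a d = 0"
proof (rule ccontr)
  assume "a d \<noteq> 0"
  define N where "N = Suc k"
  \<comment> \<open>The weight of the variable \<open>i\<close> is \<open>N ^ h i\<close>; exponents are smaller than \<open>N\<close>, so they are digits in base \<open>N\<close>.\<close>
  obtain h :: "'n \<Rightarrow> nat" where h: "bij_betw h UNIV {0..<CARD('n)}"
    using ex_bij_betw_finite_nat[of "UNIV :: 'n set"] by auto
  define e where "e c = (\<Sum>i\<in>UNIV. c i * N ^ h i)" for c :: "'n \<Rightarrow> nat"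
  have inj: "c = c'" if c: "c \<in> exponents k" "c' \<in> exponents k" and eq: "e c = e c'" for c c'
  proof
    fix i
    let ?g = "inv_into UNIV h"
    have gh: "?g (h i) = i" for i using h by (simp add: bij_betw_def inv_into_f_f)
    have e: "e c = (\<Sum>j<CARD('n). c (?g j) * N ^ j)" for c
      unfolding e_def using h by (intro sum.reindex_bij_witness[of _ ?g h])
        (auto simp: gh bij_betw_def f_inv_into_f inv_into_into image_def atLeast0LessThan)
    have lt: "c i < N" if "c \<in> exponents k" for c :: "'n \<Rightarrow> nat" and i
      using that member_le_sum[of i UNIV c] by (simp add: exponents_def N_def)
    have "h i < CARD('n)" using h by (auto simp: bij_betw_def)
    then have "c (?g (h i)) = c' (?g (h i))"
      using eq lt c unfolding e
      by (intro digits_unique[of "CARD('n)" "\<lambda>j. c (?g j)" N "\<lambda>j. c' (?g j)" "h i"]) auto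
    then show "c i = c' i" by (simp add: gh)
  qed
  define L where "L = Max (e ` exponents k)"
  have eL: "e c \<le> L" if "c \<in> exponents k" for c
    unfolding L_def using that by (simp add: finite_exponents)
  define w where "w c = (\<Prod>i\<in>UNIV. 1 / fact (c i) :: real)" for c :: "'n \<Rightarrow> nat"
  have "w c \<noteq> 0" for c by (simp add: w_def)
  define q where "q m = (\<Sum>c | c \<in> exponents k \<and> e c = m. a c * w c)" for m
  have "{c. c \<in> exponents k \<and> e c = e d} = {d}" using inj d by auto
  then have "q (e d) \<noteq> 0" using \<open>a d \<noteq> 0\<close> \<open>w d \<noteq> 0\<close> by (simp add: q_def)
  then have fin: "finite {x. (\<Sum>m\<le>L. q m * x ^ m) = 0}"
    using polyfun_finite_roots[of q L] eL[OF d] by blast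
  have "(\<Sum>m\<le>L. q m * x ^ m) = 0" if "0 \<le> x" for x
  proof -
    have "(\<Sum>m\<le>L. q m * x ^ m) = (\<Sum>m\<le>L. \<Sum>c | c \<in> exponents k \<and> e c = m. a c * w c * x ^ e c)"
      unfolding q_def sum_distrib_right by (intro sum.cong refl) auto
    also have "\<dots> = (\<Sum>c\<in>exponents k. a c * w c * x ^ e c)"
      using eL finite_exponents by (intro sum.group) auto
    also have "\<dots> = (\<Sum>c\<in>exponents k. a c * monomial c (\<lambda>i. x ^ N ^ h i))"
    proof (rule sum.cong[OF refl])
      fix c
      have "monomial c (\<lambda>i. x ^ N ^ h i) = w c * x ^ e c"
        by (simp add: monomial_def w_def e_def prod_dividef power_sum power_mult mult.commute[of "c _"])
      then show "a c * w c * x ^ e c = a c * monomial c (\<lambda>i. x ^ N ^ h i)" by simp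
    qed
    also have "\<dots> = 0" using that by (intro zero) simp
    finally show ?thesis .
  qed
  then have "{0..1} \<subseteq> {x. (\<Sum>m\<le>L. q m * x ^ m) = 0}" by auto
  then have "finite {0..1::real}" using fin finite_subset by blast
  then show False using infinite_Icc[of 0 "1::real"] by simp
qed

section \<open>Volume of the region of a principal submatrix\<close>

interpretation lborel_prod: product_sigma_finite "\<lambda>_. lborel :: real measure"
  by standard

text \<open>
  Fubini along the coordinate \<open>s\<close>: every line in this direction meets the hyperplane in one point.
\<close>

lemma null_hyperplane:
  fixes a :: "'n::finite \<Rightarrow> real"
  assumes "s \<in> K" "a s \<noteq> 0"
  shows "AE y in PiM K (\<lambda>_. lborel). (\<Sum>i\<in>K. y i * a i) \<noteq> 0"
proof -
  define J where "J = K - {s}"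
  have K: "K = insert s J" and J: "finite J" "s \<notin> J" using assms(1) by (auto simp: J_def)
  define N where "N = {y \<in> space (PiM K (\<lambda>_. lborel)). (\<Sum>i\<in>K. y i * a i) = 0}"
  have [measurable]: "N \<in> sets (PiM K (\<lambda>_. lborel))"
    unfolding N_def by measurable
  have "emeasure (PiM K (\<lambda>_. lborel)) N = (\<integral>\<^sup>+y. indicator N y \<partial>PiM (insert s J) (\<lambda>_. lborel))"
    unfolding K[symmetric] by simp
  also have "\<dots> = (\<integral>\<^sup>+x. \<integral>\<^sup>+z. indicator N (x(s := z)) \<partial>lborel \<partial>PiM J (\<lambda>_. lborel))"
    using J by (intro lborel_prod.product_nn_integral_insert) (simp_all flip: K)
  also have "\<dots> = (\<integral>\<^sup>+x. 0 \<partial>PiM J (\<lambda>_. lborel :: real measure))"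
  proof (rule nn_integral_cong)
    fix x :: "'n \<Rightarrow> real" assume x: "x \<in> space (PiM J (\<lambda>_. lborel))"
    let ?t = "- (\<Sum>i\<in>J. x i * a i) / a s"
    have "(\<integral>\<^sup>+z. indicator N (x(s := z)) \<partial>lborel) \<le> (\<integral>\<^sup>+z. indicator {?t} z \<partial>lborel)"
    proof (rule nn_integral_mono)
      fix z
      have "z = ?t" if "x(s := z) \<in> N"
      proof -
        have "(\<Sum>i\<in>J. (if i = s then z else x i) * a i) = (\<Sum>i\<in>J. x i * a i)"
          using J by (intro sum.cong) auto
        then have "z * a s + (\<Sum>i\<in>J. x i * a i) = 0"
          using that J by (simp add: N_def K)
        then show ?thesis using assms(2) by (simp add: field_simps add_eq_0_iff)
      qed
      then show "indicator N (x(s := z)) \<le> (indicator {?t} z :: ennreal)"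
        by (auto split: split_indicator)
    qed
    then show "(\<integral>\<^sup>+z. indicator N (x(s := z)) \<partial>lborel) = 0" by simp
  qed
  finally have "emeasure (PiM K (\<lambda>_. lborel)) N = 0" by simp
  then have "AE y in PiM K (\<lambda>_. lborel). y \<notin> N"
    by (intro AE_not_in) (simp add: null_sets_def)
  then show ?thesis by (auto simp: N_def elim!: AE_mp intro!: AE_I2)
qed

lemma nn_integral_power_01:
  "(\<integral>\<^sup>+t. ennreal (t ^ m) * indicator {0..1} t \<partial>lborel) = ennreal (1 / real (Suc m))"
proof -
  have "(\<integral>\<^sup>+t. ennreal (t ^ m) * indicator {0..1} t \<partial>lborel) = ennreal (1 ^ Suc m / real (Suc m) - 0 ^ Suc m / real (Suc m))"
  proof (rule nn_integral_FTC_Icc)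
    fix t :: real assume "t \<in> {0..1}"
    show "((\<lambda>t. t ^ Suc m / real (Suc m)) has_real_derivative t ^ m) (at t)"
      by (auto intro!: derivative_eq_intros simp del: power_Suc of_nat_Suc)
  qed auto
  then show ?thesis by simp
qed

context inverse_positive
begin

text \<open>
  The coordinate \<open>s\<close> of the vector \<open>u D\<close>.  For a Cartan matrix it is the coefficient of \<open>\<alpha> s\<close> in the vector
  with coordinates \<open>u\<close> in the fundamental weights of the root subsystem of \<open>K\<close>.
\<close>

definition root_coord :: "'n set \<Rightarrow> ('n \<Rightarrow> real) \<Rightarrow> 'n \<Rightarrow> real" where
  "root_coord K u s = (\<Sum>i\<in>K. u i * D K $ i $ s)"

text \<open>
  The region \<open>{y. y \<ge> 0 \<and> (u - y) D \<ge> 0}\<close>, as a set of functions on \<open>K\<close>.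
\<close>

definition region :: "'n set \<Rightarrow> ('n \<Rightarrow> real) \<Rightarrow> ('n \<Rightarrow> real) set" where
  "region K u = {y \<in> space (PiM K (\<lambda>_. lborel)). (\<forall>i\<in>K. 0 \<le> y i) \<and> (\<forall>s\<in>K. root_coord K y s \<le> root_coord K u s)}"

text \<open>
  The part of the region in which the quotient of the root coordinates of \<open>y\<close> and \<open>u\<close> is largest at \<open>s\<close>.
  If \<open>u\<close> has positive root coordinates, this is the cone with apex 0 over the facet where these two
  coordinates agree at \<open>s\<close>.
\<close>

definition facet_cone :: "'n set \<Rightarrow> ('n \<Rightarrow> real) \<Rightarrow> 'n \<Rightarrow> ('n \<Rightarrow> real) set" where
  "facet_cone K u s = {y \<in> region K u. \<forall>r\<in>K. root_coord K y r * root_coord K u s \<le> root_coord K y s * root_coord K u r}"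

lemma root_coord_nonneg: "(\<And>i. i \<in> K \<Longrightarrow> 0 \<le> u i) \<Longrightarrow> 0 \<le> root_coord K u s"
  unfolding root_coord_def by (intro sum_nonneg mult_nonneg_nonneg) (auto simp: inverse_nonneg)

lemma root_coord_scale: "root_coord K (\<lambda>i. t * u i) s = t * root_coord K u s"
  by (simp add: root_coord_def sum_distrib_left mult_ac)

lemma root_coord_diff: "root_coord K (\<lambda>i. u i - v i) s = root_coord K u s - root_coord K v s"
  by (simp add: root_coord_def left_diff_distrib sum_subtractf)

lemma root_coord_measurable [measurable]: "(\<lambda>y. root_coord K y s) \<in> borel_measurable (PiM K (\<lambda>_. lborel))"
  unfolding root_coord_def by measurable

lemma region_measurable [measurable]: "region K u \<in> sets (PiM K (\<lambda>_. lborel))"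
  unfolding region_def by measurable

lemma facet_cone_measurable [measurable]: "facet_cone K u s \<in> sets (PiM K (\<lambda>_. lborel))"
proof -
  have "facet_cone K u s = region K u \<inter> {y \<in> space (PiM K (\<lambda>_. lborel)). \<forall>r\<in>K. root_coord K y r * root_coord K u s \<le> root_coord K y s * root_coord K u r}"
    by (auto simp: facet_cone_def region_def)
  also have "\<dots> \<in> sets (PiM K (\<lambda>_. lborel))"
    by (intro sets.Int region_measurable sets.sets_Collect_finite_All borel_measurable_le
        borel_measurable_times root_coord_measurable borel_measurable_const finite)
  finally show ?thesis .
qed

lemma root_coord_remove:
  assumes "s \<in> K"
  shows "root_coord (K - {s}) u r = root_coord K u r - root_coord K u s * D K $ s $ r / D K $ s $ s"
proof -
  have nz: "D K $ s $ s \<noteq> 0" using inverse_diag_pos[OF assms] by simp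
  have "root_coord (K - {s}) u r = (\<Sum>i\<in>K. u i * D (K - {s}) $ i $ r)"
    unfolding root_coord_def by (intro sum.mono_neutral_left) (auto simp: inverse_outside)
  also have "\<dots> = root_coord K u r - root_coord K u s * D K $ s $ r / D K $ s $ s"
    unfolding root_coord_def inverse_schur[OF assms]
    by (simp add: right_diff_distrib sum_subtractf sum_distrib_right sum_divide_distrib mult.assoc)
  finally show ?thesis .
qed

lemma root_coord_cong: "(\<And>i. i \<in> K \<Longrightarrow> u i = v i) \<Longrightarrow> root_coord K u s = root_coord K v s"
  unfolding root_coord_def by (intro sum.cong) auto

text \<open>
  The inverse of the passage from \<open>u\<close> to its root coordinates.
\<close>

lemma recover_from_root_coord:
  assumes "s \<in> K" shows "u s = (\<Sum>r\<in>K. root_coord K u r * C $ r $ s)"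
proof -
  have "(\<Sum>r\<in>K. root_coord K u r * C $ r $ s) = (\<Sum>i\<in>K. u i * (\<Sum>r\<in>K. D K $ i $ r * C $ r $ s))"
    unfolding root_coord_def sum_distrib_left sum_distrib_right mult.assoc by (rule sum.swap)
  also have "\<dots> = (\<Sum>i\<in>K. u i * (if i = s then 1 else 0))"
    using assms by (intro sum.cong) (auto simp: inverse_left)
  also have "\<dots> = u s" using assms by (simp add: if_distrib cong: if_cong)
  finally show ?thesis by simp
qed

text \<open>
  The slice of the cone over the facet of \<open>s\<close> on which the root coordinate at \<open>s\<close> is \<open>t\<close> times that of \<open>u\<close>.
  Forgetting the coordinate \<open>s\<close>, it becomes the region of \<open>K - {s}\<close> scaled by \<open>t\<close>; the value \<open>z\<close> is the
  forgotten coordinate.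
\<close>

lemma slice_iff:
  fixes x :: "'n \<Rightarrow> real" and t :: real
  assumes s: "s \<in> K" and u: "\<And>i. 0 \<le> u i" and pos: "root_coord K u s > 0"
    and x: "x \<in> space (PiM (K - {s}) (\<lambda>_. lborel))"
    and z: "z = - (\<Sum>i\<in>K - {s}. x i * D K $ i $ s) / D K $ s $ s + root_coord K u s / D K $ s $ s * t"
  shows "x(s := z) \<in> facet_cone K u s \<longleftrightarrow> t \<in> {0..1} \<and> x \<in> region (K - {s}) (\<lambda>i. t * u i)"
proof -
  let ?y = "x(s := z)" and ?J = "K - {s}"
  have d: "D K $ s $ s > 0" using inverse_diag_pos[OF s] .
  have y: "?y \<in> space (PiM K (\<lambda>_. lborel))"
    using x s by (auto simp: space_PiM PiE_iff extensional_def)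
  have ys: "root_coord K ?y s = t * root_coord K u s"
  proof -
    have "root_coord K ?y s = z * D K $ s $ s + (\<Sum>i\<in>?J. x i * D K $ i $ s)"
      unfolding root_coord_def using s by (simp add: sum.remove)
    then show ?thesis using d by (simp add: z field_simps)
  qed
  have yr: "root_coord K ?y r = root_coord ?J x r + t * root_coord K u s * D K $ s $ r / D K $ s $ s" for r
  proof -
    have "root_coord ?J ?y r = root_coord ?J x r" by (rule root_coord_cong) auto
    then show ?thesis using root_coord_remove[OF s, of ?y r] ys by simp
  qed
  have le_iff: "root_coord K ?y r \<le> t * root_coord K u r \<longleftrightarrow> root_coord ?J x r \<le> root_coord ?J (\<lambda>i. t * u i) r" for r
    unfolding yr root_coord_scale root_coord_remove[OF s, of u r] by (simp add: algebra_simps)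
  have mem: "?y \<in> facet_cone K u s \<longleftrightarrow> (\<forall>i\<in>K. 0 \<le> ?y i) \<and> (\<forall>r\<in>K. root_coord K ?y r \<le> root_coord K u r)
      \<and> (\<forall>r\<in>K. root_coord K ?y r \<le> t * root_coord K u r)"
  proof -
    have "root_coord K ?y r * root_coord K u s \<le> root_coord K ?y s * root_coord K u r \<longleftrightarrow> root_coord K ?y r \<le> t * root_coord K u r" for r
      using pos unfolding ys by (simp add: mult.assoc mult.left_commute mult.commute[of _ "root_coord K u s"])
    then show ?thesis using y by (auto simp: facet_cone_def region_def)
  qed
  show ?thesis
  proof
    assume "?y \<in> facet_cone K u s"
    then have nn: "\<forall>i\<in>K. 0 \<le> ?y i" and le: "\<forall>r\<in>K. root_coord K ?y r \<le> root_coord K u r" and le': "\<forall>r\<in>K. root_coord K ?y r \<le> t * root_coord K u r"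
      using mem by blast+
    have "0 \<le> root_coord K ?y s" using nn by (intro root_coord_nonneg) auto
    then have "0 \<le> t" using pos ys by (simp add: zero_le_mult_iff)
    moreover have "t \<le> 1" using le s ys pos by auto
    moreover have "\<forall>i\<in>?J. 0 \<le> x i" using nn by (auto split: if_splits)
    ultimately show "t \<in> {0..1} \<and> x \<in> region ?J (\<lambda>i. t * u i)"
      using le' le_iff x by (auto simp: region_def)
  next
    assume R: "t \<in> {0..1} \<and> x \<in> region ?J (\<lambda>i. t * u i)"
    have le': "root_coord K ?y r \<le> t * root_coord K u r" if "r \<in> K" for r
    proof (cases "r = s")
      case False
      then have "root_coord ?J x r \<le> root_coord ?J (\<lambda>i. t * u i) r" using R that by (auto simp: region_def)
      then show ?thesis using le_iff by blast
    qed (simp add: ys)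
    moreover have "t * root_coord K u r \<le> root_coord K u r" for r
      using R root_coord_nonneg[of K u r] u by (auto intro: mult_left_le_one_le)
    ultimately have le: "root_coord K ?y r \<le> root_coord K u r" if "r \<in> K" for r
      using that by (meson order_trans)
    \<comment> \<open>The difference \<open>t u - y\<close> has non-negative root coordinates, and coordinate 0 at \<open>s\<close>, so its \<open>s\<close>-th weight coordinate involves only non-positive entries of \<open>C\<close>.\<close>
    have "t * u s - z = t * u s - ?y s" by simp
    also have "\<dots> = (\<Sum>r\<in>K. root_coord K (\<lambda>i. t * u i - ?y i) r * C $ r $ s)"
      by (rule recover_from_root_coord[OF s, of "\<lambda>i. t * u i - ?y i"])
    also have "\<dots> = (\<Sum>r\<in>K. (t * root_coord K u r - root_coord K ?y r) * C $ r $ s)"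
      by (simp only: root_coord_diff[of K "\<lambda>i. t * u i" ?y] root_coord_scale)
    also have "\<dots> \<le> 0"
    proof (rule sum_nonpos)
      fix r assume r: "r \<in> K"
      show "(t * root_coord K u r - root_coord K ?y r) * C $ r $ s \<le> 0"
        using le'[OF r] offdiag[of r s] ys by (cases "r = s") (auto intro: mult_nonneg_nonpos)
    qed
    finally have "0 \<le> z" using R u[of s] by (smt (verit) atLeastAtMost_iff mult_nonneg_nonneg)
    then have "\<forall>i\<in>K. 0 \<le> ?y i" using R by (auto simp: region_def)
    then show "?y \<in> facet_cone K u s" using mem le le' by blast
  qed
qed

text \<open>
  The volume of a cone: the substitution of \<open>t\<close> for the coordinate \<open>s\<close> has Jacobian
  \<open>root_coord K u s / D K $ s $ s\<close>, and integrating the volumes of the slices gives the factor \<open>1 / card K\<close>.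
\<close>

lemma emeasure_facet_cone:
  assumes s: "s \<in> K" and u: "\<And>i. 0 \<le> u i" and pos: "root_coord K u s > 0"
    and v: "0 \<le> v" "\<And>t. 0 \<le> t \<Longrightarrow> emeasure (PiM (K - {s}) (\<lambda>_. lborel)) (region (K - {s}) (\<lambda>i. t * u i)) = ennreal (t ^ card (K - {s}) * v)"
  shows "emeasure (PiM K (\<lambda>_. lborel)) (facet_cone K u s) = ennreal (root_coord K u s / D K $ s $ s * v / real (card K))"
proof -
  define J where "J = K - {s}"
  have K: "K = insert s J" and J: "finite J" "s \<notin> J" using s by (auto simp: J_def)
  have cK: "card K = Suc (card J)" using J by (simp add: K)
  let ?L = "\<lambda>K. PiM K (\<lambda>_. lborel :: real measure)"
  define c where "c = root_coord K u s / D K $ s $ s"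
  have c: "c > 0" using pos inverse_diag_pos[OF s] by (simp add: c_def)
  define z where "z x t = - (\<Sum>i\<in>J. x i * D K $ i $ s) / D K $ s $ s + c * t" for x :: "'n \<Rightarrow> real" and t
  have upd [measurable]: "(\<lambda>(x, t). x(s := z x t)) \<in> measurable (?L J \<Otimes>\<^sub>M lborel) (?L K)"
  proof -
    have 1: "(\<lambda>p. z (fst p) (snd p)) \<in> borel_measurable (?L J \<Otimes>\<^sub>M lborel)"
      unfolding z_def by measurable
    have "(\<lambda>p. (fst p)(s := z (fst p) (snd p))) \<in> measurable (?L J \<Otimes>\<^sub>M lborel) (?L K)"
      unfolding K by (rule measurable_fun_upd[where J = J]) (use 1 in auto)
    then show ?thesis by (simp add: case_prod_beta')
  qed
  have "emeasure (?L K) (facet_cone K u s) = (\<integral>\<^sup>+y. indicator (facet_cone K u s) y \<partial>?L (insert s J))"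
    unfolding K[symmetric] by simp
  also have "\<dots> = (\<integral>\<^sup>+x. \<integral>\<^sup>+z. indicator (facet_cone K u s) (x(s := z)) \<partial>lborel \<partial>?L J)"
    using J by (intro lborel_prod.product_nn_integral_insert) (simp_all flip: K)
  also have "\<dots> = (\<integral>\<^sup>+x. \<integral>\<^sup>+t. ennreal c * indicator (facet_cone K u s) (x(s := z x t)) \<partial>lborel \<partial>?L J)"
  proof (rule nn_integral_cong)
    fix x assume x: "x \<in> space (?L J)"
    have "(\<lambda>z. x(s := z)) \<in> measurable lborel (?L K)"
      unfolding K by (rule measurable_fun_upd[where J = J]) (use x in auto)
    then have m: "(\<lambda>z. indicator (facet_cone K u s) (x(s := z)) :: ennreal) \<in> borel_measurable lborel"
      by measurable
    then have "(\<integral>\<^sup>+z. indicator (facet_cone K u s) (x(s := z)) \<partial>lborel) =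
       ennreal \<bar>c\<bar> * (\<integral>\<^sup>+t. indicator (facet_cone K u s) (x(s := z x t)) \<partial>lborel)"
      unfolding z_def using c by (intro nn_integral_real_affine) auto
    also have "\<dots> = (\<integral>\<^sup>+t. ennreal c * indicator (facet_cone K u s) (x(s := z x t)) \<partial>lborel)"
    proof (subst nn_integral_cmult)
      have "(\<lambda>t. z x t) \<in> borel_measurable lborel" unfolding z_def by measurable
      then show "(\<lambda>t. indicator (facet_cone K u s) (x(s := z x t)) :: ennreal) \<in> borel_measurable lborel"
        using measurable_compose[OF _ m[unfolded measurable_lborel1]] by simp
    qed (use c in simp)
    finally show "(\<integral>\<^sup>+z. indicator (facet_cone K u s) (x(s := z)) \<partial>lborel) =
       (\<integral>\<^sup>+t. ennreal c * indicator (facet_cone K u s) (x(s := z x t)) \<partial>lborel)" .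
  qed
  also have "\<dots> = (\<integral>\<^sup>+t. \<integral>\<^sup>+x. ennreal c * indicator (facet_cone K u s) (x(s := z x t)) \<partial>?L J \<partial>lborel)"
  proof -
    interpret J: sigma_finite_measure "?L J" using J(1) by (rule lborel_prod.sigma_finite)
    interpret P: pair_sigma_finite "?L J" "lborel :: real measure" by standard
    have "(\<lambda>p. indicator (facet_cone K u s) ((fst p)(s := z (fst p) (snd p))) :: ennreal) \<in> borel_measurable (?L J \<Otimes>\<^sub>M lborel)"
      using measurable_compose[OF upd borel_measurable_indicator[OF facet_cone_measurable]]
      by (simp add: case_prod_beta')
    then have "(\<lambda>(x, t). ennreal c * indicator (facet_cone K u s) (x(s := z x t))) \<in> borel_measurable (?L J \<Otimes>\<^sub>M lborel)"
      by (simp add: case_prod_beta')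
    then show ?thesis by (rule P.Fubini'[symmetric])
  qed
  also have "\<dots> = (\<integral>\<^sup>+t. ennreal (c * v) * (ennreal (t ^ card J) * indicator {0..1} t) \<partial>lborel)"
  proof (rule nn_integral_cong)
    fix t :: real
    have "(\<integral>\<^sup>+x. ennreal c * indicator (facet_cone K u s) (x(s := z x t)) \<partial>?L J)
       = (\<integral>\<^sup>+x. ennreal c * indicator {0..1} t * indicator (region J (\<lambda>i. t * u i)) x \<partial>?L J)"
    proof (rule nn_integral_cong)
      fix x assume x: "x \<in> space (?L J)"
      have "x(s := z x t) \<in> facet_cone K u s \<longleftrightarrow> t \<in> {0..1} \<and> x \<in> region J (\<lambda>i. t * u i)"
        unfolding J_def by (rule slice_iff[OF s u pos]) (use x in \<open>simp_all add: J_def z_def c_def\<close>)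
      then show "ennreal c * indicator (facet_cone K u s) (x(s := z x t)) =
         ennreal c * indicator {0..1} t * indicator (region J (\<lambda>i. t * u i)) x"
        by (simp split: split_indicator)
    qed
    also have "\<dots> = ennreal c * indicator {0..1} t * emeasure (?L J) (region J (\<lambda>i. t * u i))"
      by (rule nn_integral_cmult_indicator) simp
    also have "\<dots> = ennreal (c * v) * (ennreal (t ^ card J) * indicator {0..1} t)"
    proof (cases "t \<in> {0..1}")
      case True
      then have "emeasure (?L J) (region J (\<lambda>i. t * u i)) = ennreal (t ^ card J * v)"
        using v(2)[of t] by (simp add: J_def)
      then show ?thesis using True c v(1) by (simp add: ennreal_mult mult_ac)
    qed simp
    finally show "(\<integral>\<^sup>+x. ennreal c * indicator (facet_cone K u s) (x(s := z x t)) \<partial>?L J)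
       = ennreal (c * v) * (ennreal (t ^ card J) * indicator {0..1} t)" .
  qed
  also have "\<dots> = ennreal (c * v) * ennreal (1 / real (Suc (card J)))"
    by (subst nn_integral_cmult) (simp_all only: nn_integral_power_01, measurable)
  also have "\<dots> = ennreal (c * v / real (card K))"
    using c v(1) by (simp add: cK flip: ennreal_mult)
  finally show ?thesis by (simp add: c_def)
qed

text \<open>
  The cones over the facets overlap only in the hyperplanes where two quotients are equal.
\<close>

lemma emeasure_region_sum:
  assumes u: "\<And>i. 0 \<le> u i" and pos: "\<And>s. s \<in> K \<Longrightarrow> root_coord K u s > 0" and "K \<noteq> {}"
  shows "emeasure (PiM K (\<lambda>_. lborel)) (region K u) = (\<Sum>s\<in>K. emeasure (PiM K (\<lambda>_. lborel)) (facet_cone K u s))"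
proof -
  let ?L = "PiM K (\<lambda>_. lborel :: real measure)"
  have ties: "AE y in ?L. root_coord K y r * root_coord K u s \<noteq> root_coord K y s * root_coord K u r" if rs: "r \<in> K" "s \<in> K" "r \<noteq> s" for r s
  proof -
    let ?a = "\<lambda>i. D K $ i $ r * root_coord K u s - D K $ i $ s * root_coord K u r"
    \<comment> \<open>Otherwise two columns of the invertible matrix \<open>D\<close> would be linearly dependent.\<close>
    have "\<exists>i\<in>K. ?a i \<noteq> 0"
    proof (rule ccontr)
      assume "\<not> ?thesis"
      then have "0 = (\<Sum>i\<in>K. C $ r $ i * ?a i)" by simp
      also have "\<dots> = (\<Sum>i\<in>K. C $ r $ i * D K $ i $ r) * root_coord K u s - (\<Sum>i\<in>K. C $ r $ i * D K $ i $ s) * root_coord K u r"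
        by (simp add: right_diff_distrib sum_subtractf sum_distrib_right mult.assoc)
      also have "\<dots> = root_coord K u s" using rs by (simp add: inverse_right)
      finally show False using pos[OF rs(2)] by simp
    qed
    then obtain i where i: "i \<in> K" "?a i \<noteq> 0" by blast
    have eq: "(\<Sum>i\<in>K. y i * ?a i) = root_coord K y r * root_coord K u s - root_coord K y s * root_coord K u r" for y
      by (simp add: root_coord_def right_diff_distrib sum_subtractf sum_distrib_right mult.assoc)
    show ?thesis using null_hyperplane[of i K ?a, OF i] unfolding eq by simp
  qed
  have "AE y in ?L. \<forall>r\<in>K. \<forall>s\<in>K. r \<noteq> s \<longrightarrow> root_coord K y r * root_coord K u s \<noteq> root_coord K y s * root_coord K u r"
    using ties by (intro AE_finite_allI) auto
  then have "AE y in ?L. indicator (region K u) y = (\<Sum>s\<in>K. indicator (facet_cone K u s) y :: ennreal)"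
  proof eventually_elim
    case (elim y)
    show ?case
    proof (cases "y \<in> region K u")
      case False
      then show ?thesis by (simp add: facet_cone_def)
    next
      case True
      let ?q = "\<lambda>s. root_coord K y s / root_coord K u s"
      have "Max (?q ` K) \<in> ?q ` K" using assms(3) by simp
      then obtain s where s: "s \<in> K" "?q s = Max (?q ` K)" by auto
      \<comment> \<open>The point lies in the cone of an index at which the quotient is maximal, and off the ties in no other.\<close>
      have le: "?q r \<le> ?q s" if "r \<in> K" for r unfolding s(2) using that by simp
      have ys: "y \<in> facet_cone K u s"
        unfolding facet_cone_def using True le pos s(1) by (auto simp: field_simps)
      have "y \<notin> facet_cone K u r" if "r \<in> K - {s}" for r
      proof
        assume "y \<in> facet_cone K u r"
        then have "root_coord K y s * root_coord K u r \<le> root_coord K y r * root_coord K u s" using s(1) by (auto simp: facet_cone_def)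
        moreover have "root_coord K y r * root_coord K u s \<le> root_coord K y s * root_coord K u r" using ys that by (auto simp: facet_cone_def)
        ultimately show False using elim that s(1) by force
      qed
      then have "(\<Sum>r\<in>K. indicator (facet_cone K u r) y :: ennreal) = indicator (facet_cone K u s) y"
        using s(1) by (simp add: sum.remove[of K s])
      then show ?thesis using True ys by simp
    qed
  qed
  then have "(\<integral>\<^sup>+y. indicator (region K u) y \<partial>?L) = (\<integral>\<^sup>+y. (\<Sum>s\<in>K. indicator (facet_cone K u s) y) \<partial>?L)"
    by (rule nn_integral_cong_AE)
  also have "\<dots> = (\<Sum>s\<in>K. \<integral>\<^sup>+y. indicator (facet_cone K u s) y \<partial>?L)"
    by (rule nn_integral_sum) simp
  finally show ?thesis by simp
qed

text \<open>
  A vanishing root coordinate of \<open>u\<close> forces the coordinate \<open>y s\<close> to be 0, so the region is flat.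
\<close>

lemma null_region:
  assumes s: "s \<in> K" and "root_coord K u s \<le> 0"
  shows "emeasure (PiM K (\<lambda>_. lborel)) (region K u) = 0"
proof -
  have "AE y in PiM K (\<lambda>_. lborel). (\<Sum>i\<in>K. y i * (if i = s then 1 else 0)) \<noteq> (0::real)"
    by (rule null_hyperplane[OF s]) simp
  then have "AE y in PiM K (\<lambda>_. lborel). y \<notin> region K u"
  proof eventually_elim
    case (elim y)
    then have ys: "y s \<noteq> 0" using s by (simp add: if_distrib cong: if_cong)
    show ?case
    proof
      assume R: "y \<in> region K u"
      then have nn: "0 \<le> y i" if "i \<in> K" for i using that by (simp add: region_def)
      have "y s * D K $ s $ s \<le> root_coord K y s"
        unfolding root_coord_def using s nn inverse_nonneg by (intro member_le_sum) auto
      also have "\<dots> \<le> 0" using R s assms(2) by (force simp: region_def)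
      finally show False using nn[OF s] ys inverse_diag_pos[OF s] by (simp add: mult_le_0_iff)
    qed
  qed
  then show ?thesis by (subst (asm) AE_iff_measurable[where N = "region K u"]) (auto simp: region_def)
qed

lemma root_coord_remove_eq_0:
  assumes "\<And>i. 0 \<le> u i" "r \<in> K" "root_coord K u s = 0" shows "root_coord (K - {r}) u s = 0"
proof (rule antisym)
  have "0 \<le> root_coord K u r * D K $ r $ s / D K $ r $ r"
    using root_coord_nonneg[of K u r] assms inverse_nonneg by (intro divide_nonneg_nonneg mult_nonneg_nonneg) auto
  then show "root_coord (K - {r}) u s \<le> 0" using assms by (simp add: root_coord_remove)
  show "0 \<le> root_coord (K - {r}) u s" using assms by (intro root_coord_nonneg) auto
qed

end

context ordered_inverse_positive
begin

lemma volume_poly_rec':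
  assumes "K \<noteq> {}"
  shows "volume_poly K u = (\<Sum>s\<in>K. root_coord K u s / D K $ s $ s * volume_poly (K - {s}) u / real (card K))"
proof -
  have "real (card K) \<noteq> 0" using assms by simp
  then show ?thesis
    using volume_poly_rec[OF assms, of u, folded root_coord_def]
    unfolding sum_divide_distrib[symmetric] by (simp add: nonzero_eq_divide_eq mult.commute)
qed

lemma volume_poly_nonneg:
  assumes "\<And>i. 0 \<le> u i" shows "0 \<le> volume_poly K u"
proof (induction "card K" arbitrary: K rule: less_induct)
  case less
  show ?case
  proof (cases "K = {}")
    case False
    have "0 \<le> volume_poly (K - {s}) u" if "s \<in> K" for s
      by (rule less) (use that in \<open>simp only: card_Diff1_less finite\<close>)
    then show ?thesis
      unfolding volume_poly_rec'[OF False] using root_coord_nonneg assms inverse_nonneg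
      by (intro sum_nonneg divide_nonneg_nonneg mult_nonneg_nonneg) auto
  qed (simp add: volume_poly_empty)
qed

lemma volume_poly_scale: "volume_poly K (\<lambda>i. t * u i) = t ^ card K * volume_poly K u"
proof -
  have "monomial c (\<lambda>i. t * u i) = t ^ card K * monomial c u" if "c \<in> exponents (card K)" for c
    using that by (simp add: monomial_def exponents_def power_mult_distrib prod.distrib prod_dividef power_sum[symmetric])
  then show ?thesis by (simp add: volume_poly_def sum_distrib_left mult_ac)
qed

lemma volume_poly_eq_0:
  assumes "\<And>i. 0 \<le> u i" "s \<in> K" "root_coord K u s = 0" shows "volume_poly K u = 0"
  using assms(2,3)
proof (induction "card K" arbitrary: K rule: less_induct)
  case less
  have "root_coord K u r * volume_poly (K - {r}) u = 0" if "r \<in> K" for r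
  proof (cases "r = s")
    case False
    have "volume_poly (K - {r}) u = 0"
      by (rule less(1)[OF card_Diff1_less])
        (use that False less(2,3) in \<open>auto simp: root_coord_remove_eq_0 assms(1)\<close>)
    then show ?thesis by simp
  qed (simp add: less)
  then have "(\<Sum>r\<in>K. root_coord K u r / D K $ r $ r * volume_poly (K - {r}) u / real (card K)) = 0"
    by (intro sum.neutral) auto
  then show ?case using volume_poly_rec'[of K u] less(2) by auto
qed

text \<open>
  Induction on the size of \<open>K\<close>.  The cone decomposition requires positive root coordinates; if one of
  them vanishes, the region is a null set and the polynomial is 0 at \<open>u\<close>.
\<close>

theorem emeasure_region:
  assumes "\<And>i. 0 \<le> u i"
  shows "emeasure (PiM K (\<lambda>_. lborel)) (region K u) = ennreal (volume_poly K u)"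
  using assms
proof (induction "card K" arbitrary: K u rule: less_induct)
  case less
  show ?case
  proof (cases "K = {}")
    case True
    have "region {} u = {\<lambda>_. undefined}" by (auto simp: region_def space_PiM)
    then show ?thesis using True by (simp add: volume_poly_empty emeasure_PiM_empty)
  next
    case False
    show ?thesis
    proof (cases "\<exists>s\<in>K. root_coord K u s = 0")
      case True
      then obtain s where "s \<in> K" "root_coord K u s = 0" by blast
      then show ?thesis using null_region[of s K u] volume_poly_eq_0[of u s K] less(2) by simp
    next
      case nz: False
      have pos: "root_coord K u s > 0" if "s \<in> K" for s
        using nz that root_coord_nonneg[of K u s] less(2) by force
      have "emeasure (PiM K (\<lambda>_. lborel)) (facet_cone K u s)
         = ennreal (root_coord K u s / D K $ s $ s * volume_poly (K - {s}) u / real (card K))" if s: "s \<in> K" for s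
      proof (rule emeasure_facet_cone[OF s less(2) pos[OF s] volume_poly_nonneg[OF less(2)]])
        fix t :: real assume "0 \<le> t"
        then have "emeasure (PiM (K - {s}) (\<lambda>_. lborel)) (region (K - {s}) (\<lambda>i. t * u i))
           = ennreal (volume_poly (K - {s}) (\<lambda>i. t * u i))"
          using s less(2) by (intro less(1)[OF card_Diff1_less]) auto
        then show "emeasure (PiM (K - {s}) (\<lambda>_. lborel)) (region (K - {s}) (\<lambda>i. t * u i))
           = ennreal (t ^ card (K - {s}) * volume_poly (K - {s}) u)"
          by (simp only: volume_poly_scale)
      qed
      then have "emeasure (PiM K (\<lambda>_. lborel)) (region K u)
         = (\<Sum>s\<in>K. ennreal (root_coord K u s / D K $ s $ s * volume_poly (K - {s}) u / real (card K)))"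
        using emeasure_region_sum[OF less(2) pos False] by simp
      also have "\<dots> = ennreal (volume_poly K u)"
        unfolding volume_poly_rec'[OF False, of u]
        using less(2) inverse_nonneg root_coord_nonneg volume_poly_nonneg
        by (intro sum_ennreal divide_nonneg_nonneg mult_nonneg_nonneg) auto
      finally show ?thesis .
    qed
  qed
qed

end

section \<open>Lebesgue measure of linear images\<close>

lemma distr_PiM_basis:
  fixes b :: "'i::finite \<Rightarrow> 'a::euclidean_space"
  assumes b: "bij_betw b UNIV Basis"
  shows "distr (PiM UNIV (\<lambda>_. lborel)) borel (\<lambda>f. \<Sum>i\<in>UNIV. f i *\<^sub>R b i) = lborel"
proof (rule lborel_eqI[symmetric])
  have bB: "b i \<in> Basis" for i using b by (auto simp: bij_betw_def)
  have bb: "b i \<bullet> b j = (if i = j then 1 else 0)" for i j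
    using inner_Basis[OF bB bB] b by (auto simp: bij_betw_def inj_on_def)
  fix l u :: 'a assume le: "\<And>b. b \<in> Basis \<Longrightarrow> l \<bullet> b \<le> u \<bullet> b"
  have "(\<lambda>f. \<Sum>i\<in>UNIV. f i *\<^sub>R b i) -` box l u \<inter> space (PiM UNIV (\<lambda>_. lborel)) = (\<Pi>\<^sub>E i\<in>UNIV. {l \<bullet> b i <..< u \<bullet> b i})"
  proof -
    have "(\<Sum>i\<in>UNIV. f i *\<^sub>R b i) \<bullet> b j = f j" for f j
      by (simp add: inner_sum_left bb if_distrib cong: if_cong)
    then have "(\<Sum>i\<in>UNIV. f i *\<^sub>R b i) \<in> box l u \<longleftrightarrow> (\<forall>j. l \<bullet> b j < f j \<and> f j < u \<bullet> b j)" for f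
    proof -
      have B: "(Basis :: 'a set) = range b" using b by (simp add: bij_betw_def)
      then show ?thesis
        unfolding box_def B using \<open>\<And>f j. (\<Sum>i\<in>UNIV. f i *\<^sub>R b i) \<bullet> b j = f j\<close> by simp
    qed
    then show ?thesis by (auto simp: space_PiM PiE_iff)
  qed
  then have "emeasure (distr (PiM UNIV (\<lambda>_. lborel)) borel (\<lambda>f. \<Sum>i\<in>UNIV. f i *\<^sub>R b i)) (box l u)
     = (\<Prod>i\<in>UNIV. emeasure lborel {l \<bullet> b i <..< u \<bullet> b i})"
    by (subst emeasure_distr) (auto simp: lborel_prod.emeasure_PiM)
  also have "\<dots> = (\<Prod>i\<in>UNIV. ennreal ((u - l) \<bullet> b i))"
    using le bB by (intro prod.cong) (auto simp: inner_diff_left)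
  also have "\<dots> = ennreal (\<Prod>i\<in>UNIV. (u - l) \<bullet> b i)"
    using le bB by (intro prod_ennreal) (auto simp: inner_diff_left)
  also have "(\<Prod>i\<in>UNIV. (u - l) \<bullet> b i) = (\<Prod>b\<in>Basis. (u - l) \<bullet> b)"
    using prod.reindex_bij_betw[OF b, of "\<lambda>b. (u - l) \<bullet> b"] by simp
  finally show "emeasure (distr (PiM UNIV (\<lambda>_. lborel)) borel (\<lambda>f. \<Sum>i\<in>UNIV. f i *\<^sub>R b i)) (box l u)
     = ennreal (\<Prod>b\<in>Basis. (u - l) \<bullet> b)" .
qed simp

lemma bij_axis: "bij_betw (\<lambda>i::'n::finite. axis i (1::real)) UNIV Basis"
  by (auto simp: bij_betw_def inj_on_def axis_eq_axis Basis_vec_def)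

lemma sum_axis: "(\<Sum>i\<in>UNIV. f i *\<^sub>R axis i 1) = (\<chi> i. f i)" for f :: "'n::finite \<Rightarrow> real"
  by (simp add: vec_eq_iff axis_def if_distrib cong: if_cong)

lemma distr_PiM_vec: "distr (PiM UNIV (\<lambda>_. lborel)) borel (\<lambda>f. \<chi> i. f i) = (lborel :: (real ^ 'n::finite) measure)"
  using distr_PiM_basis[OF bij_axis[where 'n='n]] by (simp add: sum_axis)

context
  fixes b :: "'i::finite \<Rightarrow> 'a::euclidean_space"
  assumes b: "bij_betw b UNIV Basis"
begin

text \<open>
  The isometry from coordinate vectors that an indexing of the standard basis defines, and below
  its inverse.  It transfers results about \<open>real ^ 'i\<close> to any Euclidean space of the same dimension.
\<close>

definition coord_iso :: "real ^ 'i \<Rightarrow> 'a" where "coord_iso x = (\<Sum>i\<in>UNIV. x $ i *\<^sub>R b i)"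

definition coord_inv :: "'a \<Rightarrow> real ^ 'i" where "coord_inv v = (\<chi> i. v \<bullet> b i)"

lemma basis_inner: "b i \<bullet> b j = (if i = j then 1 else 0)"
proof -
  have "b i \<in> Basis" "b j \<in> Basis" using b by (auto simp: bij_betw_def)
  from inner_Basis[OF this] show ?thesis using b by (auto simp: bij_betw_def inj_on_def)
qed

lemma linear_coord_iso: "linear coord_iso"
  by (rule linearI) (auto simp: coord_iso_def scaleR_add_left sum.distrib scaleR_sum_right)

lemma linear_coord_inv: "linear coord_inv"
  by (rule linearI) (auto simp: coord_inv_def inner_add_left vec_eq_iff)

lemma coord_inv_iso: "coord_inv (coord_iso x) = x"
  by (simp add: coord_iso_def coord_inv_def inner_sum_left basis_inner vec_eq_iff if_distrib cong: if_cong)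

lemma coord_iso_inv: "coord_iso (coord_inv v) = v"
  using euclidean_representation[of v] sum.reindex_bij_betw[OF b, of "\<lambda>x. (v \<bullet> x) *\<^sub>R x"]
  by (simp add: coord_iso_def coord_inv_def)

lemma coord_iso_inner: "coord_iso x \<bullet> coord_iso y = x \<bullet> y"
  by (simp add: coord_iso_def inner_sum_left inner_sum_right basis_inner inner_vec_def if_distrib mult.commute cong: if_cong)

lemma distr_coord_iso: "distr lborel borel coord_iso = lborel"
proof -
  have m: "coord_iso \<in> borel \<rightarrow>\<^sub>M borel"
    using linear_coord_iso linear_continuous_on linear_linear borel_measurable_continuous_onI by blast
  have "(\<lambda>f. \<Sum>i\<in>UNIV. f i *\<^sub>R axis i 1) \<in> PiM UNIV (\<lambda>_. lborel :: real measure) \<rightarrow>\<^sub>M (borel :: (real ^ 'i) measure)"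
    by measurable
  then have "(\<lambda>f. \<chi> i. f i) \<in> PiM UNIV (\<lambda>_. lborel :: real measure) \<rightarrow>\<^sub>M (borel :: (real ^ 'i) measure)"
    by (simp only: sum_axis)
  then have "distr (distr (PiM UNIV (\<lambda>_. lborel)) borel (\<lambda>f. \<chi> i. f i)) borel coord_iso
      = distr (PiM UNIV (\<lambda>_. lborel)) borel (coord_iso \<circ> (\<lambda>f. \<chi> i. f i))"
    using m by (intro distr_distr)
  also have "coord_iso \<circ> (\<lambda>f. \<chi> i. f i) = (\<lambda>f. \<Sum>i\<in>UNIV. f i *\<^sub>R b i)"
    by (auto simp: coord_iso_def)
  finally show ?thesis by (simp add: distr_PiM_vec distr_PiM_basis[OF b])
qed

lemma measure_coord_iso:
  assumes "compact S" shows "measure lebesgue (coord_iso ` S) = measure lebesgue S"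
proof -
  have m: "coord_iso \<in> borel \<rightarrow>\<^sub>M borel"
    using linear_coord_iso linear_continuous_on linear_linear borel_measurable_continuous_onI by blast
  have "compact (coord_iso ` S)"
    using assms linear_coord_iso linear_continuous_on linear_linear compact_continuous_image by blast
  then have [measurable]: "coord_iso ` S \<in> sets borel" "S \<in> sets borel"
    using assms by (auto intro: compact_imp_closed borel_closed)
  have "coord_iso -` coord_iso ` S = S"
    using coord_inv_iso by (intro inj_vimage_image_eq injI) metis
  then have "measure (distr lborel borel coord_iso) (coord_iso ` S) = measure lborel S"
    using m by (subst measure_distr) auto
  then show ?thesis by (simp add: distr_coord_iso)
qed

lemma measure_coord_inv:
  assumes "compact S" shows "measure lebesgue (coord_inv ` S) = measure lebesgue S"
proof -
  have "compact (coord_inv ` S)"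
    using assms linear_coord_inv linear_continuous_on linear_linear compact_continuous_image by blast
  from measure_coord_iso[OF this] show ?thesis by (simp add: image_image coord_iso_inv)
qed

end

text \<open>
  A copy of a finite linearly ordered type that is an instance of the class \<open>wellorder\<close>: every finite
  linear order is a well-order.  The lemma \<open>measure_linear_image\<close> is stated for index types of that class.
\<close>

typedef (overloaded) 'n wo_copy = "UNIV :: 'n::{finite,linorder} set" by auto

instance wo_copy :: ("{finite,linorder}") finite
proof
  have "(UNIV :: 'a wo_copy set) = range Abs_wo_copy" using Abs_wo_copy_cases by blast
  then show "finite (UNIV :: 'a wo_copy set)" by (metis finite finite_imageI)
qed

instantiation wo_copy :: ("{finite,linorder}") wellorder
begin

definition less_eq_wo_copy :: "'a wo_copy \<Rightarrow> 'a wo_copy \<Rightarrow> bool" where "less_eq_wo_copy x y \<longleftrightarrow> Rep_wo_copy x \<le> Rep_wo_copy y"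
definition less_wo_copy :: "'a wo_copy \<Rightarrow> 'a wo_copy \<Rightarrow> bool" where "less_wo_copy x y \<longleftrightarrow> Rep_wo_copy x < Rep_wo_copy y"

instance
proof
  fix P :: "'a wo_copy \<Rightarrow> bool" and a
  assume step: "\<And>x. (\<And>y. y < x \<Longrightarrow> P y) \<Longrightarrow> P x"
  show "P a"
  proof (induction "card {y. y < a}" arbitrary: a rule: less_induct)
    case less
    show ?case
    proof (rule step)
      fix y assume y: "y < a"
      have "{z. z < y} \<subset> {z. z < a}" using y by (auto simp: less_wo_copy_def)
      then show "P y" by (intro less) (simp add: psubset_card_mono)
    qed
  qed
qed (auto simp: less_eq_wo_copy_def less_wo_copy_def Rep_wo_copy_inject[symmetric])

end

lemma bij_Rep_wo_copy: "bij Rep_wo_copy"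
  by (metis Abs_wo_copy_inverse Rep_wo_copy_inverse UNIV_I bijI')

lemma det_reindex:
  fixes A :: "real ^ 'n::finite ^ 'n" and f :: "'m::finite \<Rightarrow> 'n"
  assumes f: "bij f"
  shows "det (\<chi> i j. A $ f i $ f j) = det A"
proof -
  let ?g = "map_permutation UNIV f"
  have inj: "inj f" using f by (simp add: bij_def)
  have "det A = (\<Sum>p | p permutes UNIV. of_int (sign p) * (\<Prod>i\<in>UNIV. A $ i $ p i))"
    by (simp add: det_def)
  also have "\<dots> = (\<Sum>p | p permutes (UNIV :: 'm set). of_int (sign (?g p)) * (\<Prod>i\<in>UNIV. A $ i $ ?g p i))"
  proof (rule sum.reindex_bij_witness[of _ ?g "map_permutation UNIV (inv f)"])
    fix p :: "'m \<Rightarrow> 'm" assume "p \<in> {p. p permutes UNIV}"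
    then have p: "p permutes UNIV" by simp
    show "map_permutation UNIV (inv f) (?g p) = p"
      using map_permutation_compose_inv[of f UNIV UNIV p "inv f"] f p inj by simp
    show "?g p \<in> {p. p permutes UNIV}" using map_permutation_permutes[OF f p] by simp
  next
    fix p :: "'n \<Rightarrow> 'n" assume "p \<in> {p. p permutes UNIV}"
    then have p: "p permutes UNIV" by simp
    show "?g (map_permutation UNIV (inv f) p) = p"
      using map_permutation_compose_inv[of "inv f" UNIV UNIV p f] f p
      by (simp add: bij_imp_bij_inv bij_is_surj surj_f_inv_f)
    show "map_permutation UNIV (inv f) p \<in> {p. p permutes UNIV}"
      using map_permutation_permutes[OF bij_imp_bij_inv[OF f] p] by simp
    show "of_int (sign (?g (map_permutation UNIV (inv f) p))) * (\<Prod>i\<in>UNIV. A $ i $ ?g (map_permutation UNIV (inv f) p) i)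
      = of_int (sign p) * (\<Prod>i\<in>UNIV. A $ i $ p i)"
      unfolding \<open>?g (map_permutation UNIV (inv f) p) = p\<close> ..
  qed
  also have "\<dots> = (\<Sum>p | p permutes (UNIV :: 'm set). of_int (sign p) * (\<Prod>i\<in>UNIV. A $ f i $ f (p i)))"
  proof (rule sum.cong[OF refl])
    fix p :: "'m \<Rightarrow> 'm" assume "p \<in> {p. p permutes UNIV}"
    then have p: "p permutes UNIV" by simp
    have "(\<Prod>i\<in>UNIV. A $ i $ ?g p i) = (\<Prod>i\<in>UNIV. A $ f i $ ?g p (f i))"
      using prod.reindex_bij_betw[OF f, of "\<lambda>i. A $ i $ ?g p i"] by simp
    then show "of_int (sign (?g p)) * (\<Prod>i\<in>UNIV. A $ i $ ?g p i) = of_int (sign p) * (\<Prod>i\<in>UNIV. A $ f i $ f (p i))"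
      using sign_map_permutation[OF inj p] map_permutation_apply[OF inj, of _ p] by simp
  qed
  finally show ?thesis by (simp add: det_def)
qed

lemma compact_linear_image:
  fixes f :: "'a::euclidean_space \<Rightarrow> 'b::real_normed_vector"
  assumes "linear f" "compact S" shows "compact (f ` S)"
  using assms linear_continuous_on linear_linear compact_continuous_image by blast

text \<open>
  The index type is replaced by its copy; this permutes rows and columns of the matrix simultaneously
  and leaves the determinant unchanged.
\<close>

lemma measure_linear_image_compact:
  fixes f :: "real ^ 'n::{finite,linorder} \<Rightarrow> real ^ 'n::{finite,linorder}"
  assumes f: "linear f" and S: "compact S"
  shows "measure lebesgue (f ` S) = \<bar>det (matrix f)\<bar> * measure lebesgue S"
proof -
  define b :: "'n wo_copy \<Rightarrow> real ^ 'n::{finite,linorder}" where "b i = axis (Rep_wo_copy i) 1" for i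
  have b: "bij_betw b UNIV Basis"
    unfolding b_def using bij_betw_trans[OF bij_Rep_wo_copy bij_axis] by (simp add: comp_def)
  let ?E = "coord_iso b" and ?F = "coord_inv b"
  define g where "g = ?F \<circ> f \<circ> ?E"
  have g: "linear g"
    unfolding g_def by (intro linear_compose linear_coord_iso[OF b] linear_coord_inv[OF b] f)
  have FS: "compact (?F ` S)" using S linear_coord_inv[OF b] by (rule compact_linear_image[rotated])
  have "measure lebesgue (f ` S) = measure lebesgue (?F ` f ` S)"
    using measure_coord_inv[OF b compact_linear_image[OF f S]] by simp
  also have "?F ` f ` S = g ` ?F ` S"
    by (simp add: g_def image_image coord_iso_inv[OF b])
  also have "measure lebesgue (g ` ?F ` S) = \<bar>det (matrix g)\<bar> * measure lebesgue (?F ` S)"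
    by (rule measure_linear_image[OF g lmeasurable_compact[OF FS]])
  also have "measure lebesgue (?F ` S) = measure lebesgue S" by (rule measure_coord_inv[OF b S])
  also have "matrix g = (\<chi> i j. matrix f $ Rep_wo_copy i $ Rep_wo_copy j)"
  proof -
    have E: "?E (axis j 1) = axis (Rep_wo_copy j) 1" for j
      by (simp add: coord_iso_def[OF b] b_def axis_def[of j] if_distrib[of "\<lambda>x. x *\<^sub>R _"] cong: if_cong)
    show ?thesis
      by (subst vec_eq_iff, subst vec_eq_iff) (simp add: matrix_def g_def coord_inv_def[OF b] E b_def inner_axis)
  qed
  also have "det (\<chi> i j. matrix f $ Rep_wo_copy i $ Rep_wo_copy j) = det (matrix f)"
    by (rule det_reindex[OF bij_Rep_wo_copy])
  finally show ?thesis .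
qed

lemma exists_basis_index:
  assumes "card (UNIV :: 'n::finite set) = DIM('a::euclidean_space)"
  obtains b :: "'n::finite \<Rightarrow> 'a::euclidean_space" where "bij_betw b UNIV Basis"
  using finite_same_card_bij[of "UNIV :: 'n set" "Basis :: 'a set"] assms by auto

lemma measure_isometry_image:
  fixes f :: "'a::euclidean_space \<Rightarrow> 'a"
  assumes dim: "card (UNIV :: 'n::{finite,linorder} set) = DIM('a)"
    and f: "linear f" "\<And>v w. f v \<bullet> f w = v \<bullet> w" and S: "compact S"
  shows "measure lebesgue (f ` S) = measure lebesgue S"
proof -
  obtain b :: "'n \<Rightarrow> 'a" where b: "bij_betw b UNIV Basis" using exists_basis_index[OF dim] .
  let ?E = "coord_iso b" and ?F = "coord_inv b"
  define g where "g = ?F \<circ> f \<circ> ?E"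
  have lg: "linear g"
    unfolding g_def by (intro linear_compose linear_coord_iso[OF b] linear_coord_inv[OF b] f)
  have "g x \<bullet> g y = x \<bullet> y" for x y
    using coord_iso_inner[OF b, of "g x" "g y"] f(2) by (simp add: g_def coord_iso_inv[OF b] coord_iso_inner[OF b])
  then have og: "orthogonal_transformation g" using lg by (simp add: orthogonal_transformation_def)
  have FS: "compact (?F ` S)" using S linear_coord_inv[OF b] by (rule compact_linear_image[rotated])
  have "measure lebesgue (f ` S) = measure lebesgue (?F ` f ` S)"
    using measure_coord_inv[OF b compact_linear_image[OF f(1) S]] by simp
  also have "?F ` f ` S = g ` ?F ` S"
    by (simp add: g_def image_image coord_iso_inv[OF b])
  also have "measure lebesgue (g ` ?F ` S) = measure lebesgue (?F ` S)"
    using measure_linear_image_compact[OF lg FS] orthogonal_transformation_det[OF og] by simp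
  also have "\<dots> = measure lebesgue S" by (rule measure_coord_inv[OF b S])
  finally show ?thesis .
qed

lemma measure_linear_image_factor:
  fixes T :: "real ^ 'n::{finite,linorder} \<Rightarrow> 'a::euclidean_space"
  assumes dim: "CARD('n) = DIM('a)" and T: "linear T" "inj T"
  obtains \<kappa> where "0 < \<kappa>" "\<And>S. compact S \<Longrightarrow> measure lebesgue (T ` S) = \<kappa> * measure lebesgue S"
proof -
  obtain b :: "'n \<Rightarrow> 'a" where b: "bij_betw b UNIV Basis" using exists_basis_index[OF dim] .
  let ?E = "coord_iso b" and ?F = "coord_inv b"
  have lg: "linear (?F \<circ> T)" by (intro linear_compose linear_coord_inv[OF b] T)
  have "inj ?F" by (metis coord_iso_inv[OF b] injI)
  then have "inj (?F \<circ> T)" using T(2) by (rule inj_compose)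
  then have "det (matrix (?F \<circ> T)) \<noteq> 0" using lg det_nz_iff_inj by blast
  moreover have "measure lebesgue (T ` S) = \<bar>det (matrix (?F \<circ> T))\<bar> * measure lebesgue S" if S: "compact S" for S
  proof -
    have "measure lebesgue (T ` S) = measure lebesgue (?F ` T ` S)"
      using measure_coord_inv[OF b compact_linear_image[OF T(1) S]] by simp
    also have "?F ` T ` S = (?F \<circ> T) ` S" by (simp add: image_image)
    also have "measure lebesgue \<dots> = \<bar>det (matrix (?F \<circ> T))\<bar> * measure lebesgue S"
      by (rule measure_linear_image_compact[OF lg S])
    finally show ?thesis .
  qed
  ultimately show thesis using that[of "\<bar>det (matrix (?F \<circ> T))\<bar>"] by simp
qed

section \<open>Volume of the weight polytope\<close>

context root_basis
begin

text \<open>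
  Simple roots form pairwise non-acute angles, and therefore the dual basis of any subset of them lies in
  the cone that the subset spans.  Split the combination as \<open>P - N\<close> into its positive and negative
  part: \<open>N \<bullet> (P - N) \<ge> 0\<close> and \<open>N \<bullet> P \<le> 0\<close> give \<open>N = 0\<close>.
\<close>

lemma simple_combination_nonneg:
  assumes "\<And>i. i \<in> K \<Longrightarrow> 0 \<le> \<alpha> i \<bullet> (\<Sum>k\<in>K. m k *\<^sub>R \<alpha> k)" "k \<in> K"
  shows "0 \<le> m k"
proof -
  \<comment> \<open>Positive and negative parts of the coefficients.\<close>
  define p q where "p k = max (m k) 0" and "q k = max (- m k) 0" for k
  let ?P = "\<Sum>k\<in>K. p k *\<^sub>R \<alpha> k" and ?N = "\<Sum>k\<in>K. q k *\<^sub>R \<alpha> k"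
  have pq: "0 \<le> p k" "0 \<le> q k" "p k * q k = 0" "m k = p k - q k" for k
    by (auto simp: p_def q_def max_def)
  have V: "(\<Sum>k\<in>K. m k *\<^sub>R \<alpha> k) = ?P - ?N"
    by (simp add: pq(4) scaleR_left_diff_distrib sum_subtractf)
  have "0 \<le> ?N \<bullet> (?P - ?N)"
    unfolding V[symmetric] inner_sum_left[of _ K] inner_scaleR_left
    using assms(1) pq(2) by (intro sum_nonneg mult_nonneg_nonneg) auto
  moreover have "?N \<bullet> ?P \<le> 0"
    unfolding inner_sum_left inner_sum_right
  proof (intro sum_nonpos)
    fix i j assume "i \<in> K" "j \<in> K"
    show "(q i *\<^sub>R \<alpha> i) \<bullet> (p j *\<^sub>R \<alpha> j) \<le> 0"
    proof (cases "i = j")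
      case True
      then show ?thesis using pq(3)[of i] by auto
    next
      case False
      then show ?thesis using simple_obtuse[OF False] pq by (simp add: mult_nonneg_nonpos)
    qed
  qed
  ultimately have "?N \<bullet> ?N \<le> 0" by (simp add: inner_diff_right)
  then have "?N = 0" by (metis inner_eq_zero_iff inner_ge_zero order_antisym)
  moreover have "?N = (\<Sum>k\<in>UNIV. (if k \<in> K then q k else 0) *\<^sub>R \<alpha> k)"
    by (intro sum.mono_neutral_cong_left) auto
  ultimately have "(if k \<in> K then q k else 0) * ((\<alpha> k \<bullet> \<alpha> k) / 2) = 0"
    using simple_sum_inner[of "\<lambda>k. if k \<in> K then q k else 0" k] by simp
  then have "q k = 0" using assms(2) simple_nonzero[of k] by simp
  then show ?thesis using pq(1)[of k] pq(4)[of k] by simp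
qed

abbreviation C :: "real ^ 'n ^ 'n" where "C \<equiv> cartan_matrix \<alpha>"

lemma cartan_nth: "C $ i $ j = 2 * (\<alpha> i \<bullet> \<alpha> j) / (\<alpha> j \<bullet> \<alpha> j)"
  by (simp add: cartan_matrix_def)

lemma cartan_sum_eq_inner:
  "(\<Sum>k\<in>K. C $ i $ k * x k) = \<alpha> i \<bullet> (\<Sum>k\<in>K. (2 * x k / (\<alpha> k \<bullet> \<alpha> k)) *\<^sub>R \<alpha> k)"
  by (simp add: cartan_nth inner_sum_right mult_ac)

lemma cartan_nonneg:
  assumes "\<And>i. i \<in> K \<Longrightarrow> 0 \<le> (\<Sum>k\<in>K. C $ i $ k * x k)" "k \<in> K"
  shows "0 \<le> x k"
proof -
  have "0 \<le> 2 * x k / (\<alpha> k \<bullet> \<alpha> k)"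
    using assms unfolding cartan_sum_eq_inner by (rule simple_combination_nonneg)
  then show ?thesis using simple_inner_pos[of k] by (simp add: zero_le_divide_iff)
qed

lemma cartan_eq_0:
  assumes "\<And>i. i \<in> K \<Longrightarrow> (\<Sum>k\<in>K. C $ i $ k * x k) = 0" "k \<in> K"
  shows "x k = 0"
proof (rule antisym)
  show "0 \<le> x k" using assms by (intro cartan_nonneg[of K x]) auto
  have "0 \<le> - x k" using assms by (intro cartan_nonneg[of K "\<lambda>k. - x k"]) (auto simp: sum_negf)
  then show "x k \<le> 0" by simp
qed

text \<open>
  The inverse is cut out of the inverse of the matrix \<open>A\<close> that agrees with \<open>C\<close> on \<open>K \<times> K\<close> and with the
  identity matrix elsewhere.
\<close>

lemma exists_principal_inverse: "\<exists>D. is_principal_inverse C K D"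
proof -
  define A :: "real ^ 'n ^ 'n" where
    "A = (\<chi> i j. if i \<in> K \<and> j \<in> K then C $ i $ j else if i = j then 1 else 0)"
  have in_K: "(\<Sum>k\<in>UNIV. A $ i $ k * x k) = (\<Sum>k\<in>K. C $ i $ k * x k)" if "i \<in> K" for i x
    using that by (intro sum.mono_neutral_cong_right) (auto simp: A_def)
  have in_K': "(\<Sum>k\<in>UNIV. x k * A $ k $ j) = (\<Sum>k\<in>K. x k * C $ k $ j)" if "j \<in> K" for j x
    using that by (intro sum.mono_neutral_cong_right) (auto simp: A_def)
  \<comment> \<open>\<open>A\<close> is injective, because the submatrix is positive definite up to scaling of its columns.\<close>
  have "x = 0" if "A *v x = 0" for x
  proof -
    have Ax: "(\<Sum>k\<in>UNIV. A $ i $ k * x $ k) = 0" for i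
      using that by (simp add: matrix_vector_mult_def vec_eq_iff)
    have "x $ k = 0" if "k \<in> K" for k
    proof (rule cartan_eq_0[of K "\<lambda>k. x $ k"])
      show "(\<Sum>k\<in>K. C $ i $ k * x $ k) = 0" if "i \<in> K" for i
        using in_K[OF that, of "\<lambda>k. x $ k"] Ax[of i] by simp
    qed (rule that)
    moreover have "x $ k = 0" if "k \<notin> K" for k
    proof -
      have "(\<Sum>j\<in>UNIV. A $ k $ j * x $ j) = (\<Sum>j\<in>UNIV. if k = j then x $ k else 0)"
        using that by (intro sum.cong) (auto simp: A_def)
      then show ?thesis using Ax[of k] by simp
    qed
    ultimately show "x = 0" by (auto simp: vec_eq_iff)
  qed
  then obtain B where BA: "B ** A = mat 1"
    using matrix_left_invertible_ker by blast
  then have AB: "A ** B = mat 1" using matrix_left_right_inverse by blast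
  have "is_principal_inverse C K (\<chi> i j. if i \<in> K \<and> j \<in> K then B $ i $ j else 0)"
    unfolding is_principal_inverse_def
  proof (intro conjI allI ballI impI)
    fix i j assume ij: "i \<in> K" "j \<in> K"
    have "(\<Sum>k\<in>K. C $ i $ k * (\<chi> i j. if i \<in> K \<and> j \<in> K then B $ i $ j else 0) $ k $ j) = (\<Sum>k\<in>K. C $ i $ k * B $ k $ j)"
      using ij by (intro sum.cong) auto
    also have "\<dots> = (A ** B) $ i $ j" using in_K[OF ij(1)] by (simp add: matrix_matrix_mult_def)
    finally show "(\<Sum>k\<in>K. C $ i $ k * (\<chi> i j. if i \<in> K \<and> j \<in> K then B $ i $ j else 0) $ k $ j) = (if i = j then 1 else 0)"
      by (simp add: AB mat_def)
    have "(\<Sum>k\<in>K. (\<chi> i j. if i \<in> K \<and> j \<in> K then B $ i $ j else 0) $ i $ k * C $ k $ j) = (\<Sum>k\<in>K. B $ i $ k * C $ k $ j)"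
      using ij by (intro sum.cong) auto
    also have "\<dots> = (B ** A) $ i $ j" using in_K'[OF ij(2)] by (simp add: matrix_matrix_mult_def)
    finally show "(\<Sum>k\<in>K. (\<chi> i j. if i \<in> K \<and> j \<in> K then B $ i $ j else 0) $ i $ k * C $ k $ j) = (if i = j then 1 else 0)"
      by (simp add: BA mat_def)
  qed auto
  then show ?thesis by blast
qed

lemma principal_inverse_cartan: "is_principal_inverse C K (principal_inverse C K)"
  using exists_principal_inverse[of K] principal_inverse_eqI by blast

lemma principal_inverse_nonneg: "0 \<le> principal_inverse C K $ i $ j"
proof (cases "i \<in> K \<and> j \<in> K")
  case True
  then show ?thesis
    using principal_inverse_cartan[of K] unfolding is_principal_inverse_def
    by (intro cartan_nonneg[of K "\<lambda>k. principal_inverse C K $ k $ j"]) auto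
next
  case False
  then show ?thesis using principal_inverse_cartan[of K] unfolding is_principal_inverse_def by auto
qed

lemma principal_inverse_diag_pos:
  assumes r: "r \<in> K" shows "0 < principal_inverse C K $ r $ r"
proof -
  let ?D = "principal_inverse C K"
  define m where "m k = 2 * ?D $ k $ r / (\<alpha> k \<bullet> \<alpha> k)" for k
  let ?V = "\<Sum>k\<in>K. m k *\<^sub>R \<alpha> k"
  have inner: "\<alpha> i \<bullet> ?V = (if i = r then 1 else 0)" if "i \<in> K" for i
    using principal_inverse_cartan[of K] that r
    unfolding is_principal_inverse_def m_def cartan_sum_eq_inner by auto
  then have "?V \<noteq> 0" using r by fastforce
  then have "0 < ?V \<bullet> ?V" by simp
  also have "?V \<bullet> ?V = (\<Sum>k\<in>K. m k * (\<alpha> k \<bullet> ?V))" by (subst inner_sum_left) simp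
  also have "\<dots> = (\<Sum>k\<in>K. m k * (if k = r then 1 else 0))" using inner by (intro sum.cong) auto
  also have "\<dots> = m r" using r by (simp add: if_distrib cong: if_cong)
  finally show ?thesis using simple_inner_pos[of r] by (simp add: m_def zero_less_divide_iff)
qed

sublocale cartan: inverse_positive C
proof
  show "C $ i $ j \<le> 0" if "i \<noteq> j" for i j
    using simple_obtuse[OF that] simple_inner_pos[of j] by (simp add: cartan_nth divide_le_0_iff)
qed (simp_all add: principal_inverse_cartan principal_inverse_nonneg principal_inverse_diag_pos)

lemma inverse_eq_weight_inner:
  "principal_inverse C UNIV $ i $ j = 2 * (\<omega> i \<bullet> \<omega> j) / (\<alpha> j \<bullet> \<alpha> j)"
proof -
  have "is_principal_inverse C UNIV (\<chi> i j. 2 * (\<omega> i \<bullet> \<omega> j) / (\<alpha> j \<bullet> \<alpha> j))"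
    unfolding is_principal_inverse_def
  proof (intro conjI allI ballI impI)
    fix i j
    have "(\<Sum>k\<in>UNIV. C $ i $ k * (\<chi> i j. 2 * (\<omega> i \<bullet> \<omega> j) / (\<alpha> j \<bullet> \<alpha> j)) $ k $ j)
       = 2 * ((\<Sum>k\<in>UNIV. (2 * (\<alpha> i \<bullet> \<alpha> k) / (\<alpha> k \<bullet> \<alpha> k)) *\<^sub>R \<omega> k) \<bullet> \<omega> j) / (\<alpha> j \<bullet> \<alpha> j)"
      by (simp add: cartan_nth inner_sum_left sum_distrib_left sum_divide_distrib mult_ac)
    also have "\<dots> = 2 * (\<alpha> i \<bullet> \<omega> j) / (\<alpha> j \<bullet> \<alpha> j)" by (simp flip: weight_expansion)
    also have "\<dots> = (if i = j then 1 else 0)"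
      using simple_nonzero[of j] by (simp add: inner_commute[of "\<alpha> i" "\<omega> j"] fundamental_weight_inner)
    finally show "(\<Sum>k\<in>UNIV. C $ i $ k * (\<chi> i j. 2 * (\<omega> i \<bullet> \<omega> j) / (\<alpha> j \<bullet> \<alpha> j)) $ k $ j) = (if i = j then 1 else 0)" .
    have "(\<Sum>k\<in>UNIV. (\<chi> i j. 2 * (\<omega> i \<bullet> \<omega> j) / (\<alpha> j \<bullet> \<alpha> j)) $ i $ k * C $ k $ j)
       = 2 * ((\<Sum>k\<in>UNIV. (2 * (\<omega> i \<bullet> \<omega> k) / (\<alpha> k \<bullet> \<alpha> k)) *\<^sub>R \<alpha> k) \<bullet> \<alpha> j) / (\<alpha> j \<bullet> \<alpha> j)"
      by (simp add: cartan_nth inner_sum_left sum_distrib_left sum_divide_distrib mult_ac)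
    also have "\<dots> = 2 * (\<omega> i \<bullet> \<alpha> j) / (\<alpha> j \<bullet> \<alpha> j)" by (simp flip: simple_expansion)
    also have "\<dots> = (if i = j then 1 else 0)"
      using simple_nonzero[of j] by (simp add: fundamental_weight_inner)
    finally show "(\<Sum>k\<in>UNIV. (\<chi> i j. 2 * (\<omega> i \<bullet> \<omega> j) / (\<alpha> j \<bullet> \<alpha> j)) $ i $ k * C $ k $ j) = (if i = j then 1 else 0)" .
  qed auto
  from principal_inverse_eqI[OF this] show ?thesis by simp
qed

text \<open>
  Up to positive column factors \<open>C\<close> is the Gram matrix of the simple roots.
\<close>

lemma det_cartan_pos: "0 < det C"
proof -
  obtain b :: "'n \<Rightarrow> 'a" where b: "bij_betw b UNIV Basis" using exists_basis_index[OF card_index] .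
  define A :: "real ^ 'n ^ 'n" where "A = (\<chi> i k. \<alpha> i \<bullet> b k)"
  have gram: "(A ** transpose A) $ i $ j = \<alpha> i \<bullet> \<alpha> j" for i j
    using sum.reindex_bij_betw[OF b, of "\<lambda>x. (\<alpha> i \<bullet> x) * (\<alpha> j \<bullet> x)"]
    by (simp add: A_def matrix_matrix_mult_def transpose_def euclidean_inner[of "\<alpha> i" "\<alpha> j"])
  have "transpose C $ j $ i = C $ i $ j" for i j by (simp add: transpose_def)
  then have "transpose C = (\<chi> j. (2 / (\<alpha> j \<bullet> \<alpha> j)) *s (A ** transpose A) $ j)"
    by (simp add: vec_eq_iff cartan_nth gram inner_commute)
  then have "det (transpose C) = (\<Prod>j\<in>UNIV. 2 / (\<alpha> j \<bullet> \<alpha> j)) * det (A ** transpose A)"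
    by (simp add: det_rows_mul vec_lambda_eta)
  then have "det C = (\<Prod>j\<in>UNIV. 2 / (\<alpha> j \<bullet> \<alpha> j)) * (det A * det A)"
    by (simp add: det_mul)
  then have "0 \<le> det C" by (simp add: prod_nonneg)
  moreover have "det C \<noteq> 0"
  proof -
    have "C ** principal_inverse C UNIV = mat 1"
      by (simp add: vec_eq_iff matrix_matrix_mult_def mat_def cartan.inverse_right)
    then have "det C * det (principal_inverse C UNIV) = 1" by (metis det_I det_mul)
    then show ?thesis by auto
  qed
  ultimately show ?thesis by simp
qed

end

text \<open>
  The linear order on the indices is needed for ordered products.
\<close>

locale ordered_root_basis = root_basis \<Phi> \<alpha>
  for \<Phi> :: "'a::euclidean_space set" and \<alpha> :: "'n::{finite,linorder} \<Rightarrow> 'a"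
begin

sublocale cartan: ordered_inverse_positive C ..

text \<open>
  The vector with given coordinates in the fundamental weights, and below the inverse map.
\<close>

definition weight_sum :: "real ^ 'n::{finite,linorder} \<Rightarrow> 'a" where "weight_sum y = (\<Sum>i\<in>UNIV. y $ i *\<^sub>R \<omega> i)"

definition weight_coords :: "'a \<Rightarrow> real ^ 'n::{finite,linorder}" where
  "weight_coords x = (\<chi> i. 2 * (x \<bullet> \<alpha> i) / (\<alpha> i \<bullet> \<alpha> i))"

lemma linear_weight_sum: "linear weight_sum"
  by (rule linearI) (auto simp: weight_sum_def scaleR_add_left sum.distrib scaleR_sum_right)

lemma linear_weight_coords: "linear weight_coords"
  by (rule linearI) (auto simp: weight_coords_def inner_add_left vec_eq_iff add_divide_distrib algebra_simps)

lemma weight_sum_coords: "weight_sum (weight_coords x) = x"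
  unfolding weight_sum_def weight_coords_def using weight_expansion[of x] by simp

lemma weight_sum_inner: "weight_sum y \<bullet> \<alpha> i = y $ i * ((\<alpha> i \<bullet> \<alpha> i) / 2)"
  by (simp add: weight_sum_def inner_sum_left fundamental_weight_inner if_distrib cong: if_cong)

lemma weight_coords_sum: "weight_coords (weight_sum y) = y"
  using simple_nonzero by (simp add: weight_coords_def weight_sum_inner vec_eq_iff)

lemma weight_sum_inner_weight: "weight_sum y \<bullet> \<omega> j = cartan.root_coord UNIV (\<lambda>i. y $ i) j * ((\<alpha> j \<bullet> \<alpha> j) / 2)"
proof -
  have "y $ i * principal_inverse C UNIV $ i $ j * ((\<alpha> j \<bullet> \<alpha> j) / 2) = y $ i * (\<omega> i \<bullet> \<omega> j)" for i
    using simple_nonzero[of j] by (simp add: inverse_eq_weight_inner)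
  then show ?thesis
    by (simp only: weight_sum_def cartan.root_coord_def sum_distrib_right inner_sum_left inner_scaleR_left)
qed

text \<open>
  The region of the full Cartan matrix as a set of coordinate vectors; by
  \<open>dominant_part_weight_polytope\<close> it describes the dominant part of the weight polytope.
\<close>

definition fundamental_region :: "('n \<Rightarrow> real) \<Rightarrow> (real ^ 'n::{finite,linorder}) set" where
  "fundamental_region u = {y. (\<lambda>i. y $ i) \<in> cartan.region UNIV u}"

lemma half_norm_cancel: "r * ((\<alpha> i \<bullet> \<alpha> i) / 2) \<le> t * ((\<alpha> i \<bullet> \<alpha> i) / 2) \<longleftrightarrow> r \<le> t"
  using simple_inner_pos[of i] by (intro mult_le_cancel_right_pos) simp

lemma vec_nth_lambda: "(\<lambda>i. (\<chi> i. u i) $ i) = u"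
  by simp

lemma dominant_weight_sum: "dominant (weight_sum y) \<longleftrightarrow> (\<forall>i. 0 \<le> y $ i)"
  using half_norm_cancel[of 0] by (simp add: dominant_def weight_sum_inner)

lemma dominant_part_weight_polytope:
  assumes u: "\<And>i. 0 \<le> u i"
  shows "{x \<in> weight_polytope \<Phi> (weight_sum (\<chi> i. u i)). dominant x} = weight_sum ` fundamental_region u"
proof -
  have dom: "dominant (weight_sum (\<chi> i. u i))" using u by (simp add: dominant_weight_sum)
  have iff: "weight_sum y \<in> weight_polytope \<Phi> (weight_sum (\<chi> i. u i)) \<and> dominant (weight_sum y) \<longleftrightarrow> y \<in> fundamental_region u" for y
  proof -
    have "positive (weight_sum (\<chi> i. u i) - weight_sum y) \<longleftrightarrow> (\<forall>j. cartan.root_coord UNIV (\<lambda>i. y $ i) j \<le> cartan.root_coord UNIV u j)"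
      unfolding positive_def inner_diff_left weight_sum_inner_weight vec_nth_lambda
      by (simp only: diff_ge_0_iff_ge half_norm_cancel)
    then show ?thesis
      using dominant_mem_weight_polytope[OF dom, of "weight_sum y"] dominant_weight_sum[of y]
      by (auto simp: fundamental_region_def cartan.region_def space_PiM)
  qed
  show ?thesis
  proof (intro equalityI subsetI)
    fix x assume "x \<in> {x \<in> weight_polytope \<Phi> (weight_sum (\<chi> i. u i)). dominant x}"
    then have "weight_coords x \<in> fundamental_region u"
      using iff[of "weight_coords x"] by (simp add: weight_sum_coords)
    then show "x \<in> weight_sum ` fundamental_region u"
      using weight_sum_coords[of x] by (metis imageI)
  next
    fix x assume "x \<in> weight_sum ` fundamental_region u"
    then show "x \<in> {x \<in> weight_polytope \<Phi> (weight_sum (\<chi> i. u i)). dominant x}"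
      using iff by blast
  qed
qed

lemma compact_dominant_part: "compact {x \<in> weight_polytope \<Phi> v. dominant x}"
proof -
  have "closed (\<Inter>i. {x. \<alpha> i \<bullet> x \<ge> 0})" by (intro closed_INT) (auto intro: closed_halfspace_ge)
  moreover have "{x \<in> weight_polytope \<Phi> v. dominant x} = weight_polytope \<Phi> v \<inter> (\<Inter>i. {x. \<alpha> i \<bullet> x \<ge> 0})"
    by (auto simp: dominant_def inner_commute)
  moreover have "compact (weight_polytope \<Phi> v)"
    unfolding weight_polytope_eq using finite_orbit by (rule finite_imp_compact_convex_hull)
  ultimately show ?thesis by (metis compact_Int_closed)
qed

lemma compact_fundamental_region:
  assumes "\<And>i. 0 \<le> u i" shows "compact (fundamental_region u)"
proof -
  have "fundamental_region u = weight_coords ` weight_sum ` fundamental_region u"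
    by (simp add: image_image weight_coords_sum)
  also have "\<dots> = weight_coords ` {x \<in> weight_polytope \<Phi> (weight_sum (\<chi> i. u i)). dominant x}"
    using dominant_part_weight_polytope[of u] assms by simp
  finally show ?thesis using compact_linear_image[OF linear_weight_coords compact_dominant_part] by simp
qed

lemma measure_fundamental_region:
  assumes u: "\<And>i. 0 \<le> u i"
  shows "measure lebesgue (fundamental_region u) = cartan.volume_poly UNIV u"
proof -
  have [measurable]: "fundamental_region u \<in> sets borel"
    using compact_fundamental_region[OF u] by (intro borel_closed compact_imp_closed) auto
  have m: "(\<lambda>f. \<chi> i. f i) \<in> PiM UNIV (\<lambda>_. lborel :: real measure) \<rightarrow>\<^sub>M (borel :: (real ^ 'n::{finite,linorder}) measure)"
    unfolding sum_axis[symmetric] by measurable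
  have "emeasure lborel (fundamental_region u) =
    emeasure (distr (PiM UNIV (\<lambda>_. lborel)) borel (\<lambda>f. \<chi> i. f i)) (fundamental_region u)"
    by (simp add: distr_PiM_vec)
  also have "\<dots> = emeasure (PiM UNIV (\<lambda>_. lborel)) ((\<lambda>f. \<chi> i. f i) -` fundamental_region u \<inter> space (PiM UNIV (\<lambda>_. lborel)))"
    by (rule emeasure_distr[OF m]) simp
  also have "(\<lambda>f. \<chi> i. f i) -` fundamental_region u \<inter> space (PiM UNIV (\<lambda>_. lborel)) = cartan.region UNIV u"
    unfolding fundamental_region_def vimage_def mem_Collect_eq vec_nth_lambda
    by (auto simp: cartan.region_def)
  finally show ?thesis
    using cartan.emeasure_region[OF u, of UNIV] cartan.volume_poly_nonneg[OF u, of UNIV]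
    by (simp add: measure_def)
qed

lemma finite_weyl_group: "finite (weyl_group \<Phi>)"
  using finite_range_word weyl_group_eq_words by simp

lemma measure_weight_polytope:
  "measure lebesgue (weight_polytope \<Phi> v) =
    real (card (weyl_group \<Phi>)) * measure lebesgue {x \<in> weight_polytope \<Phi> v. dominant x}"
proof -
  let ?Q = "{x \<in> weight_polytope \<Phi> v. dominant x}"
  have lin: "linear w" and iso: "w x \<bullet> w y = x \<bullet> y" if "w \<in> weyl_group \<Phi>" for w x y
    using that linear_word word_isometry unfolding weyl_group_eq_words by auto
  have "measure lebesgue (weight_polytope \<Phi> v) = measure lebesgue (\<Union>w\<in>weyl_group \<Phi>. w ` ?Q)"
    by (rule arg_cong[OF weight_polytope_Un])
  also have "\<dots> = (\<Sum>w\<in>weyl_group \<Phi>. measure lebesgue (w ` ?Q))"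
  proof (rule measure_negligible_finite_Union_image[OF finite_weyl_group])
    fix w assume "w \<in> weyl_group \<Phi>"
    then show "w ` {x \<in> weight_polytope \<Phi> v. dominant x} \<in> lmeasurable"
      by (intro lmeasurable_compact compact_linear_image lin compact_dominant_part)
  next
    show "pairwise (\<lambda>w w'. negligible (w ` ?Q \<inter> w' ` ?Q)) (weyl_group \<Phi>)"
    proof (rule pairwiseI)
      fix w w' assume "w \<in> weyl_group \<Phi>" "w' \<in> weyl_group \<Phi>" "w \<noteq> w'"
      from negligible_chamber_overlap[OF this]
      show "negligible (w ` ?Q \<inter> w' ` ?Q)" by (rule negligible_subset) auto
    qed
  qed
  also have "\<dots> = (\<Sum>w\<in>weyl_group \<Phi>. measure lebesgue ?Q)"
    by (intro sum.cong refl measure_isometry_image[OF card_index] lin iso compact_dominant_part)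
  finally show ?thesis by simp
qed

text \<open>
  In weight coordinates the simple roots are the rows of the Cartan matrix.
\<close>

lemma parallelepiped_eq:
  "parallelepiped \<alpha> = weight_sum ` (\<lambda>t. transpose C *v t) ` cbox 0 (\<chi> i. 1)"
proof -
  have "weight_sum (transpose C *v t) = (\<Sum>i\<in>UNIV. t $ i *\<^sub>R \<alpha> i)" for t
  proof (rule eq_if_inner_simple_eq)
    fix j
    have "weight_sum (transpose C *v t) \<bullet> \<alpha> j = (\<Sum>i\<in>UNIV. C $ i $ j * t $ i) * ((\<alpha> j \<bullet> \<alpha> j) / 2)"
      by (simp add: weight_sum_inner matrix_vector_mult_def transpose_def)
    also have "\<dots> = (\<Sum>i\<in>UNIV. t $ i *\<^sub>R \<alpha> i) \<bullet> \<alpha> j"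
    proof -
      have "C $ i $ j * t $ i * ((\<alpha> j \<bullet> \<alpha> j) / 2) = t $ i * (\<alpha> i \<bullet> \<alpha> j)" for i
        using simple_nonzero[of j] by (simp add: cartan_nth)
      then show ?thesis by (simp only: sum_distrib_right inner_sum_left inner_scaleR_left)
    qed
    finally show "weight_sum (transpose C *v t) \<bullet> \<alpha> j = (\<Sum>i\<in>UNIV. t $ i *\<^sub>R \<alpha> i) \<bullet> \<alpha> j" .
  qed
  then have "weight_sum ` (\<lambda>t. transpose C *v t) ` cbox 0 (\<chi> i. 1)
     = (\<lambda>t. \<Sum>i\<in>UNIV. t $ i *\<^sub>R \<alpha> i) ` cbox 0 (\<chi> i. 1)"
    by (simp add: image_image)
  also have "\<dots> = parallelepiped \<alpha>"
  proof
    show "(\<lambda>t. \<Sum>i\<in>UNIV. t $ i *\<^sub>R \<alpha> i) ` cbox 0 (\<chi> i. 1) \<subseteq> parallelepiped \<alpha>"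
      by (auto simp: parallelepiped_def mem_box_cart)
    show "parallelepiped \<alpha> \<subseteq> (\<lambda>t. \<Sum>i\<in>UNIV. t $ i *\<^sub>R \<alpha> i) ` cbox 0 (\<chi> i. 1)"
    proof
      fix x assume "x \<in> parallelepiped \<alpha>"
      then obtain t where "x = (\<Sum>i\<in>UNIV. t i *\<^sub>R \<alpha> i)" "\<forall>i. 0 \<le> t i \<and> t i \<le> 1"
        unfolding parallelepiped_def by blast
      then show "x \<in> (\<lambda>t. \<Sum>i\<in>UNIV. t $ i *\<^sub>R \<alpha> i) ` cbox 0 (\<chi> i. 1)"
        by (intro image_eqI[of _ _ "\<chi> i. t i"]) (auto simp: mem_box_cart)
    qed
  qed
  finally show ?thesis by simp
qed

theorem volume_function_eq:
  assumes u: "\<And>i. 0 \<le> u i"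
  shows "volume_function \<Phi> \<alpha> u = real (card (weyl_group \<Phi>)) / det C * cartan.volume_poly UNIV u"
proof -
  have "inj weight_sum" by (metis injI weight_coords_sum)
  then obtain \<kappa> where \<kappa>: "0 < \<kappa>" "\<And>S. compact S \<Longrightarrow> measure lebesgue (weight_sum ` S) = \<kappa> * measure lebesgue S"
    using measure_linear_image_factor[OF card_index linear_weight_sum] by blast
  have cube: "compact ((\<lambda>t. transpose C *v t) ` cbox 0 (\<chi> i. 1))"
    by (intro compact_linear_image matrix_vector_mul_linear compact_cbox)
  have "measure lebesgue ((\<lambda>t. transpose C *v t) ` cbox 0 (\<chi> i. 1)) =
      \<bar>det (matrix (\<lambda>t. transpose C *v t))\<bar> * measure lebesgue (cbox 0 (\<chi> i. 1) :: (real ^ 'n::{finite,linorder}) set)"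
    by (rule measure_linear_image_compact[OF matrix_vector_mul_linear compact_cbox])
  then have "measure lebesgue (parallelepiped \<alpha>) = \<kappa> * (\<bar>det (transpose C)\<bar> * measure lebesgue (cbox 0 (\<chi> i. 1) :: (real ^ 'n::{finite,linorder}) set))"
    unfolding parallelepiped_eq \<kappa>(2)[OF cube] matrix_of_matrix_vector_mul by (rule arg_cong)
  also have "measure lebesgue (cbox 0 (\<chi> i. 1) :: (real ^ 'n::{finite,linorder}) set) = 1"
  proof -
    have "(0 :: real ^ 'n::{finite,linorder}) \<bullet> i \<le> (\<chi> i. 1) \<bullet> i" "((\<chi> i. 1) - 0) \<bullet> i = (1::real)" if "i \<in> Basis" for i :: "real ^ 'n::{finite,linorder}"
      using that by (auto simp: Basis_vec_def inner_axis)
    then show ?thesis by (simp add: measure_def emeasure_lborel_cbox_eq)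
  qed
  finally have par: "measure lebesgue (parallelepiped \<alpha>) = \<kappa> * det C"
    using det_cartan_pos by simp
  have chi: "(\<Sum>i\<in>UNIV. u i *\<^sub>R \<omega> i) = weight_sum (\<chi> i. u i)" by (simp add: weight_sum_def)
  have "measure lebesgue (weight_polytope \<Phi> (weight_sum (\<chi> i. u i)))
     = real (card (weyl_group \<Phi>)) * (\<kappa> * cartan.volume_poly UNIV u)"
    unfolding measure_weight_polytope dominant_part_weight_polytope[OF u] \<kappa>(2)[OF compact_fundamental_region[OF u]]
      measure_fundamental_region[OF u] ..
  then show ?thesis
    unfolding volume_function_def normalized_volume_def chi par using \<kappa>(1) by simp
qed

theorem mixed_eulerian_eq:
  assumes "(\<Sum>i\<in>UNIV. c i) = CARD('n)"
  shows "mixed_eulerian \<Phi> \<alpha> c =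
    real (card (weyl_group \<Phi>)) / det C * ordered_product (subset_matrix \<alpha>) c $ {} $ UNIV"
proof -
  define A where "A c = (if c \<in> exponents CARD('n) then
    real (card (weyl_group \<Phi>)) / det C * ordered_product (subset_matrix \<alpha>) c $ {} $ UNIV else 0)" for c
  have vol: "volume_function \<Phi> \<alpha> u = (\<Sum>c\<in>exponents CARD('n). A c * monomial c u)" if "\<And>i. 0 \<le> u i" for u
    unfolding volume_function_eq[OF that] cartan.volume_poly_def
    by (simp add: sum_distrib_left A_def subset_matrix_eq mult.assoc)
  have "mixed_eulerian \<Phi> \<alpha> = A"
    unfolding mixed_eulerian_def
  proof (rule the_equality, safe)
    fix c :: "'n \<Rightarrow> nat" assume "(\<Sum>i\<in>UNIV. c i) \<noteq> CARD('n)"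
    then show "A c = 0" by (simp add: A_def exponents_def)
  next
    fix u :: "'n \<Rightarrow> real" assume "\<forall>i. 0 \<le> u i"
    then show "volume_function \<Phi> \<alpha> u = (\<Sum>c | (\<Sum>i\<in>UNIV. c i) = CARD('n). A c * (\<Prod>i\<in>UNIV. u i ^ c i / fact (c i)))"
      using vol[of u] by (simp add: exponents_def monomial_def)
  next
    fix B :: "('n \<Rightarrow> nat) \<Rightarrow> real"
    assume B0: "\<forall>c. (\<Sum>i\<in>UNIV. c i) \<noteq> CARD('n) \<longrightarrow> B c = 0"
      and B: "\<forall>u. (\<forall>i. 0 \<le> u i) \<longrightarrow> volume_function \<Phi> \<alpha> u =
        (\<Sum>c | (\<Sum>i\<in>UNIV. c i) = CARD('n). B c * (\<Prod>i\<in>UNIV. u i ^ c i / fact (c i)))"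
    have zero: "(\<Sum>c\<in>exponents CARD('n). (B c - A c) * monomial c u) = 0" if "\<And>i. 0 \<le> u i" for u
    proof -
      have "volume_function \<Phi> \<alpha> u = (\<Sum>c\<in>exponents CARD('n). B c * monomial c u)"
        using B[rule_format, of u] that by (simp add: exponents_def monomial_def)
      then show ?thesis using vol[of u] that by (simp add: left_diff_distrib sum_subtractf)
    qed
    show "B = A"
    proof
      fix c
      show "B c = A c"
      proof (cases "c \<in> exponents CARD('n)")
        case True
        then show ?thesis using monomial_coefficients_eq_0[OF zero] by force
      next
        case False
        then show ?thesis using B0 by (simp add: A_def exponents_def)
      qed
    qed
  qed
  then show ?thesis using assms by (simp add: A_def exponents_def)
qed

end

theorem theorem1p5:
  fixes \<Phi> :: "'a::euclidean_space set"
    and \<alpha> :: "'n::{finite,linorder} \<Rightarrow> 'a"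
    and c :: "'n \<Rightarrow> nat"
  assumes "irreducible_root_system \<Phi>"
    and "simple_roots \<Phi> \<alpha>"
    and "(\<Sum>i\<in>UNIV. c i) = CARD('n)"
  shows "mixed_eulerian \<Phi> \<alpha> c =
    real (card (weyl_group \<Phi>)) / det (cartan_matrix \<alpha>) *
    ordered_product (subset_matrix \<alpha>) c $ {} $ UNIV"
proof -
  interpret ordered_root_basis \<Phi> \<alpha>
    using assms by unfold_locales (simp_all add: irreducible_root_system_def)
  show ?thesis by (rule mixed_eulerian_eq[OF assms(3)])
qed

end
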